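(* There is a numerical constant $C>0$, independent of all problem parameters, such that for all $x\in\mathcal{X}$ the multi-level Monte Carlo estimator with parameters $n$ and $n_0$ satisfies $$\mathbb{E}\,\big\|\widehat{\mathcal{M}}[\nabla\mathcal{L}_{\mathrm{CVaR}}]\big\|^2\le C\Big(1+\frac{\log\frac{n}{n_0}}{\alpha n_0}\Big)G^2\qquad\text{and}\qquad\mathbb{E}\,\big\|\widehat{\mathcal{M}}[\nabla\mathcal{L}_{\chi^2\text{-pen}}]\big\|^2\le C\Big(1+\frac{B\log\frac{n}{n_0}}{\lambda n_0}\Big)G^2.$$
   Context: Setting: $\mathcal{X}\subset\mathbb{R}^d$ is closed, convex and bounded; $P_0$ is a distribution on $\mathbb{S}$; $\ell:\mathcal{X}\times\mathbb{S}\to[0,B]$ is convex and $G$-Lipschitz in $x$, with $\nabla\ell(x;s)$ an arbitrary subgradient in $x$. Objectives on a sample $s_1^k$ ($\Delta^k$ is the simplex): for $\alpha\in(0,1]$, $\mathcal{L}_{\mathrm{CVaR}}(x;s_1^k)=\max\{\sum_iq_i\ell(x;s_i):q\in\Delta^k,\ \max_iq_i\le\frac{1}{\alpha k}\}$, and for penalty parameter $\lambda$, $\mathcal{L}_{\chi^2\text{-pen}}(x;s_1^k)=\max_{q\in\Delta^k}\{\sum_iq_i\ell(x;s_i)-\frac{\lambda}{2k}\sum_i(kq_i-1)^2\}$. In both cases $\nabla\mathcal{L}(x;s_1^k)=\sum_iq_i^\star\nabla\ell(x;s_i)$, where $q^\star$ attains the maximum. MLMC estimator with minimum sample size $n_0\ge1$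 and $n=2^{j_{\max}}n_0$: let $J\sim\min\{\mathrm{Geo}(1/2),j_{\max}\}$, i.e. $J$ takes values in $\{1,\dots,j_{\max}\}$ with $q(j)=\mathbb{P}(J=j)=2^{-j}$ for $j<j_{\max}$ and $q(j_{\max})=2^{-j_{\max}+1}$. Given $J$, draw $S_1,\dots,S_{2^Jn_0}$ i.i.d. from $P_0$. For even $k$ let $$\widehat{\mathcal{D}}_k=\nabla\mathcal{L}(x;S_1^k)-\tfrac12\big(\nabla\mathcal{L}(x;S_1^{k/2})+\nabla\mathcal{L}(x;S_{k/2+1}^k)\big),$$ and set $\widehat{\mathcal{M}}[\nabla\mathcal{L}]=\nabla\mathcal{L}(x;S_1^{n_0})+\frac{1}{q(J)}\widehat{\mathcal{D}}_{2^Jn_0}$.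
   Formalization: The chosen subgradients are assumed to have norm at most G (automatic at interior points, false bound otherwise at boundary points), and the maximiser q* is assumed to be a measurable function of the sample size and losses only, since sample-dependent tie-breaking for CVaR breaks the bound. *)

theory Defs
  imports "HOL-Probability.Probability"
begin

text \<open>
  A sample of size k is given by the values at 0, ..., k - 1 of a function on the natural numbers;
  the same holds for loss vectors and weight vectors.
  The subgradient \<open>l'\<close> is required to have norm at most \<open>G\<close>. At an interior point of \<open>X\<close> this follows
  from the subgradient inequality and the Lipschitz condition. At a boundary point it does not:
  there one may add any normal vector of \<open>X\<close> to a subgradient, and no bound in terms of
  \<open>G\<close> could hold.
\<close>

locale dro_problem = prob_space P0
  for P0 :: "'s measure" +
  fixes X :: "'a::euclidean_space set"
    and l :: "'a \<Rightarrow> 's \<Rightarrow> real"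
    and l' :: "'a \<Rightarrow> 's \<Rightarrow> 'a"
    and B G :: real
  assumes closed_X: "closed X"
    and convex_X: "convex X"
    and bounded_X: "bounded X"
    and loss_measurable: "\<And>x. x \<in> X \<Longrightarrow> l x \<in> borel_measurable P0"
    and loss_range: "\<And>x s. x \<in> X \<Longrightarrow> s \<in> space P0 \<Longrightarrow> l x s \<in> {0..B}"
    and loss_convex: "\<And>s. s \<in> space P0 \<Longrightarrow> convex_on X (\<lambda>x. l x s)"
    and loss_lipschitz: "\<And>s. s \<in> space P0 \<Longrightarrow> G-lipschitz_on X (\<lambda>x. l x s)"
    and grad_measurable: "\<And>x. x \<in> X \<Longrightarrow> l' x \<in> borel_measurable P0"
    and grad_subgradient: "\<And>x y s. x \<in> X \<Longrightarrow> y \<in> X \<Longrightarrow> s \<in> space P0 \<Longrightarrow>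
          l y s \<ge> l x s + l' x s \<bullet> (y - x)"
    and grad_norm: "\<And>x s. x \<in> X \<Longrightarrow> s \<in> space P0 \<Longrightarrow> norm (l' x s) \<le> G"

definition weight_simplex :: "nat \<Rightarrow> (nat \<Rightarrow> real) set" where
  "weight_simplex k = {w. (\<forall>i<k. 0 \<le> w i) \<and> (\<Sum>i<k. w i) = 1}"

definition cvar_weights :: "real \<Rightarrow> nat \<Rightarrow> (nat \<Rightarrow> real) set" where
  "cvar_weights \<alpha> k = {w \<in> weight_simplex k. \<forall>i<k. w i \<le> 1 / (\<alpha> * real k)}"

text \<open>
  The objectives on a sample depend on it only through the vector \<open>v\<close> of losses. The suprema are
  attained, by compactness.
\<close>

definition cvar_value :: "nat \<Rightarrow> (nat \<Rightarrow> real) \<Rightarrow> (nat \<Rightarrow> real) \<Rightarrow> real" where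
  "cvar_value k v w = (\<Sum>i<k. w i * v i)"

definition cvar_objective :: "real \<Rightarrow> nat \<Rightarrow> (nat \<Rightarrow> real) \<Rightarrow> real" where
  "cvar_objective \<alpha> k v = (SUP w\<in>cvar_weights \<alpha> k. cvar_value k v w)"

definition chi2_value :: "real \<Rightarrow> nat \<Rightarrow> (nat \<Rightarrow> real) \<Rightarrow> (nat \<Rightarrow> real) \<Rightarrow> real" where
  "chi2_value lam k v w =
     (\<Sum>i<k. w i * v i) - lam / (2 * real k) * (\<Sum>i<k. (real k * w i - 1)\<^sup>2)"

definition chi2_objective :: "real \<Rightarrow> nat \<Rightarrow> (nat \<Rightarrow> real) \<Rightarrow> real" where
  "chi2_objective lam k v = (SUP w\<in>weight_simplex k. chi2_value lam k v w)"

text \<open>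
  A selection \<open>q\<close> maps the sample size and the loss vector to a maximiser. For CVaR the maximiser
  need not be unique when losses are tied, and any measurable choice that is a function of the
  losses is admitted. A tie-breaking rule that could also look at the subgradients is excluded: it
  could favour different tied samples for different k, which would bias the differences in the
  multilevel estimator by an amount of order \<open>G\<close>.
\<close>

definition measurable_selection :: "(nat \<Rightarrow> (nat \<Rightarrow> real) \<Rightarrow> nat \<Rightarrow> real) \<Rightarrow> bool" where
  "measurable_selection q \<longleftrightarrow>
     (\<forall>k. \<forall>i<k. (\<lambda>v. q k v i) \<in> borel_measurable (PiM {..<k} (\<lambda>_. borel)))"

definition cvar_selection :: "real \<Rightarrow> (nat \<Rightarrow> (nat \<Rightarrow> real) \<Rightarrow> nat \<Rightarrow> real) \<Rightarrow> bool" where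
  "cvar_selection \<alpha> q \<longleftrightarrow> measurable_selection q \<and>
     (\<forall>k\<ge>1. \<forall>v \<in> {..<k} \<rightarrow>\<^sub>E UNIV.
        q k v \<in> cvar_weights \<alpha> k \<and> cvar_value k v (q k v) = cvar_objective \<alpha> k v)"

definition chi2_selection :: "real \<Rightarrow> (nat \<Rightarrow> (nat \<Rightarrow> real) \<Rightarrow> nat \<Rightarrow> real) \<Rightarrow> bool" where
  "chi2_selection lam q \<longleftrightarrow> measurable_selection q \<and>
     (\<forall>k\<ge>1. \<forall>v \<in> {..<k} \<rightarrow>\<^sub>E UNIV.
        q k v \<in> weight_simplex k \<and> chi2_value lam k v (q k v) = chi2_objective lam k v)"

definition robust_grad ::
  "(nat \<Rightarrow> (nat \<Rightarrow> real) \<Rightarrow> nat \<Rightarrow> real) \<Rightarrow> ('a \<Rightarrow> 's \<Rightarrow> real) \<Rightarrow> ('a \<Rightarrow> 's \<Rightarrow> 'a) \<Rightarrow>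
    'a::euclidean_space \<Rightarrow> nat \<Rightarrow> (nat \<Rightarrow> 's) \<Rightarrow> 'a" where
  "robust_grad q l l' x k s = (\<Sum>i<k. q k (\<lambda>j\<in>{..<k}. l x (s j)) i *\<^sub>R l' x (s i))"

definition mlmc_diff ::
  "(nat \<Rightarrow> (nat \<Rightarrow> real) \<Rightarrow> nat \<Rightarrow> real) \<Rightarrow> ('a \<Rightarrow> 's \<Rightarrow> real) \<Rightarrow> ('a \<Rightarrow> 's \<Rightarrow> 'a) \<Rightarrow>
    'a::euclidean_space \<Rightarrow> nat \<Rightarrow> (nat \<Rightarrow> 's) \<Rightarrow> 'a" where
  "mlmc_diff q l l' x k s =
     robust_grad q l l' x k s - (1 / 2) *\<^sub>R
       (robust_grad q l l' x (k div 2) s + robust_grad q l l' x (k div 2) (\<lambda>i. s (i + k div 2)))"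

text \<open>
  \<^const>\<open>geometric_pmf\<close> counts the failures before the first success, so it starts at 0; the level
  uses the number of trials.
\<close>

definition mlmc_level :: "nat \<Rightarrow> nat pmf" where
  "mlmc_level jmax = map_pmf (\<lambda>g. min (Suc g) jmax) (geometric_pmf (1 / 2))"

text \<open>
  Level \<open>J\<close> uses the first \<open>2 ^ J * n0\<close> terms of an i.i.d. sequence that is independent of \<open>J\<close>.
\<close>

definition mlmc_space :: "nat \<Rightarrow> 's measure \<Rightarrow> (nat \<times> (nat \<Rightarrow> 's)) measure" where
  "mlmc_space jmax P0 = measure_pmf (mlmc_level jmax) \<Otimes>\<^sub>M PiM UNIV (\<lambda>_. P0)"

definition mlmc_estimator ::
  "(nat \<Rightarrow> (nat \<Rightarrow> real) \<Rightarrow> nat \<Rightarrow> real) \<Rightarrow> ('a \<Rightarrow> 's \<Rightarrow> real) \<Rightarrow> ('a \<Rightarrow> 's \<Rightarrow> 'a) \<Rightarrow>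
    'a::euclidean_space \<Rightarrow> nat \<Rightarrow> nat \<Rightarrow> nat \<times> (nat \<Rightarrow> 's) \<Rightarrow> 'a" where
  "mlmc_estimator q l l' x n0 jmax = (\<lambda>(J, S).
     robust_grad q l l' x n0 S +
     (1 / pmf (mlmc_level jmax) J) *\<^sub>R mlmc_diff q l l' x (2 ^ J * n0) S)"

lemma pmf_mlmc_level:
  assumes "1 \<le> j" "j \<le> jmax"
  shows "pmf (mlmc_level jmax) j = (if j < jmax then (1 / 2) ^ j else (1 / 2) ^ (jmax - 1))"
proof (cases "j < jmax")
  case True
  then have "(\<lambda>g. min (Suc g) jmax) -` {j} = {j - 1}"
    using assms by (auto simp: min_def split: if_splits)
  then have "pmf (mlmc_level jmax) j = pmf (geometric_pmf (1 / 2)) (j - 1)"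
    by (simp add: mlmc_level_def pmf_map measure_pmf_single)
  also have "\<dots> = (1 / 2) ^ j"
    using assms by (cases j) auto
  finally show ?thesis using True by simp
next
  case False
  then have j: "j = jmax" using assms by simp
  have "(\<lambda>g. min (Suc g) jmax) -` {j} = UNIV - {..<jmax - 1}"
    using assms j by (auto simp: min_def split: if_splits)
  then have "pmf (mlmc_level jmax) j = 1 - measure (geometric_pmf (1 / 2)) {..<jmax - 1}"
    using measure_pmf.prob_compl[of "{..<jmax - 1}" "geometric_pmf (1 / 2)"]
    by (simp add: mlmc_level_def pmf_map)
  also have "measure (geometric_pmf (1 / 2)) {..<jmax - 1} = (\<Sum>i<jmax - 1. (1 / 2) ^ i * (1 / 2))"
    by (simp add: measure_measure_pmf_finite)
  also have "\<dots> = 1 - (1 / 2) ^ (jmax - 1)"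
    by (simp add: sum_gp_strict flip: sum_divide_distrib)
  finally show ?thesis using j by simp
qed

end

theory Submission
  imports Defs
begin

text \<open>
  The second moment of the estimator is at most
  \<open>2 * G\<^sup>2 + 2 * (\<Sum>j. E (norm D\<^sub>j)\<^sup>2 / p\<^sub>j)\<close>, where \<open>D\<^sub>j\<close> is the difference at level \<open>j\<close>, which compares a sample of
  size \<open>k = 2 ^ j * n0\<close> with its two halves, and \<open>p\<^sub>j \<ge> 2 powr (- j)\<close> is the probability of level \<open>j\<close>. A bound
  \<open>E (norm D\<^sub>j)\<^sup>2 \<le> K * G\<^sup>2 / k\<close> makes every level contribute equally, and the number of levels is
  \<open>log 2 (n / n0)\<close>. The proof therefore consists in showing this bound with \<open>K\<close> of order \<open>1 / \<alpha>\<close> for CVaR and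
  \<open>B / lam\<close> for the chi-square penalty.

  Write \<open>D\<^sub>j = (\<Sum>i<k. (q i - p i) *\<^sub>R g i)\<close> with \<open>q\<close> the maximiser on the full sample and \<open>p\<close> the average of the
  maximisers on the halves. Both weight vectors satisfy optimality conditions with the same constants, and these
  allow \<open>q - p\<close> to take both signs within one half only at tied losses. Without ties it follows that
  \<open>norm D\<^sub>j \<le> 2 * G * \<bar>Q - 1 / 2\<bar>\<close>, where \<open>Q\<close> is the mass that \<open>q\<close> gives to the first half
  (\<open>norm_half_difference_le\<close>). The sample is exchangeable and \<open>q\<close> is equivariant, so exchanging the sample
  points \<open>i\<close> and \<open>i + k / 2\<close> flips the sign of \<open>q i - q (i + k / 2)\<close> and keeps the other differences of this
  form. These are uncorrelated and \<open>E (Q - 1 / 2)\<^sup>2 = (\<Sum>i<k/2. E (q i - q (i + k / 2))\<^sup>2) / 4\<close>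
  (\<open>imbalance_second_moment_le\<close>). For CVaR this is small because the weights are at most \<open>1 / (\<alpha> * k)\<close> and
  sum to 1; for the penalised objective because moving away from the uniform weights must not cost more
  penalty than the at most \<open>B\<close> that it gains.

  For CVaR with tied losses the selection may distribute mass among the ties in an asymmetric way, and then it
  is neither equivariant nor comparable with \<open>p\<close>. Replacing \<open>q\<close> and \<open>g\<close> by their averages over tied indices
  restores the argument above. What remains is a weighted sum of the residuals of \<open>g\<close> about its tie average.
  Exchanging two tied sample points changes neither the losses nor the weights, and the residuals over a set
  of ties sum to zero; consequently the cross terms of this sum have nonpositive expectation
  (\<open>residual_cross_nonpos\<close>) and its second moment is at most \<open>4 * G\<^sup>2\<close> times any bound on the
  sum of squared weights.
\<close>

section \<open>Finite sums\<close>

lemma sum_lessThan_double: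
  fixes f :: "nat \<Rightarrow> 'b::comm_monoid_add"
  shows "(\<Sum>i<2 * h. f i) = (\<Sum>i<h. f i) + (\<Sum>i<h. f (i + h))"
proof -
  have "{..<2 * h} = {..<h} \<union> (\<lambda>i. i + h) ` {..<h}"
  proof (intro set_eqI iffI)
    fix i assume "i \<in> {..<2 * h}"
    then show "i \<in> {..<h} \<union> (\<lambda>i. i + h) ` {..<h}"
      by (cases "i < h") (auto intro!: rev_image_eqI[of "i - h"])
  qed auto
  moreover have "{..<h} \<inter> (\<lambda>i. i + h) ` {..<h} = {}"
    by auto
  moreover have "(\<Sum>i\<in>(\<lambda>i. i + h) ` {..<h}. f i) = (\<Sum>i<h. f (i + h))"
    by (subst sum.reindex) (auto simp: inj_on_def)
  ultimately show ?thesis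
    by (simp add: sum.union_disjoint)
qed

lemma transpose_less:
  fixes a b i k :: nat
  assumes "a < k" "b < k"
  shows "Transposition.transpose a b i < k \<longleftrightarrow> i < k"
  using assms by (auto simp: Transposition.transpose_def)

lemma sum_transpose:
  fixes a b k :: nat
  assumes "a < k" "b < k"
  shows "(\<Sum>i<k. w (Transposition.transpose a b i)) = (\<Sum>i<k. w i)"
  by (rule sum.reindex_bij_witness[of _ "Transposition.transpose a b" "Transposition.transpose a b"])
     (use assms in \<open>auto simp: transpose_less\<close>)

text \<open>
  If all \<open>a i\<close> have the same sign, this is the triangle inequality. Otherwise the coefficients that are not
  zero all multiply one and the same vector, and the sum factorises.
\<close>

lemma norm_sum_one_sign_le:
  fixes y :: "'i \<Rightarrow> 'b::real_normed_vector"
  assumes fin: "finite A"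
    and eq: "\<And>i j. i \<in> A \<Longrightarrow> j \<in> A \<Longrightarrow> 0 < a i \<Longrightarrow> a j < 0 \<Longrightarrow> y i = y j"
    and bound: "\<And>i. i \<in> A \<Longrightarrow> norm (y i) \<le> G"
  shows "norm (\<Sum>i\<in>A. a i *\<^sub>R y i) \<le> G * \<bar>\<Sum>i\<in>A. a i\<bar>"
proof -
  have le: "norm (\<Sum>i\<in>A. a i *\<^sub>R y i) \<le> G * (\<Sum>i\<in>A. \<bar>a i\<bar>)"
    unfolding sum_distrib_left
    by (rule order_trans[OF norm_sum sum_mono])
      (use bound in \<open>auto simp: mult.commute[of G] mult_left_mono\<close>)
  consider "\<forall>i\<in>A. 0 \<le> a i" | "\<forall>i\<in>A. a i \<le> 0" | i0 j0 where "i0 \<in> A" "0 < a i0" "j0 \<in> A" "a j0 < 0"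
    by (meson linorder_not_le)
  then show ?thesis
  proof cases
    case 1
    then have "(\<Sum>i\<in>A. \<bar>a i\<bar>) = \<bar>\<Sum>i\<in>A. a i\<bar>"
      by (simp add: sum_nonneg)
    then show ?thesis using le by simp
  next
    case 2
    then have "(\<Sum>i\<in>A. \<bar>a i\<bar>) = \<bar>\<Sum>i\<in>A. a i\<bar>"
      by (simp add: sum_nonpos sum_negf)
    then show ?thesis using le by simp
  next
    case 3
    have y: "a i *\<^sub>R y i = a i *\<^sub>R y i0" if "i \<in> A" for i
    proof (cases "a i" "0::real" rule: linorder_cases)
      case less
      then show ?thesis using eq[OF \<open>i0 \<in> A\<close> that] 3 by simp
    next
      case greater
      then show ?thesis using eq[OF that \<open>j0 \<in> A\<close>] eq[OF \<open>i0 \<in> A\<close> \<open>j0 \<in> A\<close>] 3 by simp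
    qed simp
    have "(\<Sum>i\<in>A. a i *\<^sub>R y i) = (\<Sum>i\<in>A. a i) *\<^sub>R y i0"
      unfolding scaleR_sum_left by (intro sum.cong) (auto simp: y)
    then show ?thesis
      using bound[OF \<open>i0 \<in> A\<close>] by (simp add: mult.commute[of G] mult_left_mono)
  qed
qed

section \<open>Averages over ties\<close>

definition tie_mean :: "nat \<Rightarrow> (nat \<Rightarrow> real) \<Rightarrow> (nat \<Rightarrow> 'b::real_vector) \<Rightarrow> nat \<Rightarrow> 'b" where
  "tie_mean k v f i =
     (\<Sum>j<k. (if v j = v i then 1 else 0) *\<^sub>R f j) /\<^sub>R (\<Sum>j<k. if v j = v i then 1 else 0)"

lemma tie_count_ge_1:
  fixes k :: nat
  assumes "i < k"
  shows "(1::real) \<le> (\<Sum>j<k. if v j = v i then 1 else 0)"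
proof -
  have "(if v i = v i then 1 else 0) \<le> (\<Sum>j<k. if v j = v i then 1 else 0 :: real)"
    by (rule member_le_sum) (use assms in auto)
  then show ?thesis by simp
qed

lemma tie_mean_cong: "v i = v j \<Longrightarrow> tie_mean k v f i = tie_mean k v f j"
  by (simp add: tie_mean_def)

lemma tie_mean_eq:
  assumes "i < k" "\<And>j. j < k \<Longrightarrow> v j = v i \<Longrightarrow> f j = f i"
  shows "tie_mean k v f i = f i"
proof -
  have "(\<Sum>j<k. (if v j = v i then 1 else 0) *\<^sub>R f j) = (\<Sum>j<k. if v j = v i then 1 else 0) *\<^sub>R f i"
    unfolding scaleR_sum_left by (intro sum.cong) (auto simp: assms(2))
  then show ?thesis
    using tie_count_ge_1[OF assms(1), of v] by (simp add: tie_mean_def)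
qed

text \<open>
  Averaging over ties is a self-adjoint operation: the weight with which \<open>g j\<close> enters the average at \<open>i\<close> is
  the reciprocal of the common number of ties, and so it is symmetric in \<open>i\<close> and \<open>j\<close>.
\<close>

lemma sum_tie_mean:
  fixes g :: "nat \<Rightarrow> 'b::real_vector"
  shows "(\<Sum>i<k. a i *\<^sub>R tie_mean k v g i) = (\<Sum>i<k. tie_mean k v a i *\<^sub>R g i)"
proof -
  define N where "N i = (\<Sum>j<k. if v j = v i then 1 else 0 :: real)" for i
  have "(\<Sum>i<k. a i *\<^sub>R tie_mean k v g i)
      = (\<Sum>i<k. \<Sum>j<k. (a i * inverse (N i) * (if v j = v i then 1 else 0)) *\<^sub>R g j)"
    by (simp add: tie_mean_def N_def scaleR_sum_right mult.assoc)
  also have "\<dots> = (\<Sum>j<k. \<Sum>i<k. (a i * inverse (N i) * (if v j = v i then 1 else 0)) *\<^sub>R g j)"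
    by (rule sum.swap)
  also have "\<dots> = (\<Sum>j<k. \<Sum>i<k. (inverse (N j) * ((if v i = v j then 1 else 0) * a i)) *\<^sub>R g j)"
    by (intro sum.cong refl) (auto simp: N_def)
  also have "\<dots> = (\<Sum>j<k. tie_mean k v a j *\<^sub>R g j)"
    by (simp add: tie_mean_def N_def scaleR_sum_left sum_distrib_left)
  finally show ?thesis .
qed

lemma sum_minus_tie_mean_eq_0:
  assumes "i < k"
  shows "(\<Sum>j<k. (if v j = v i then 1 else 0) *\<^sub>R (f j - tie_mean k v f j)) = 0"
proof -
  define N where "N = (\<Sum>j<k. if v j = v i then 1 else 0 :: real)"
  have "(\<Sum>j<k. (if v j = v i then 1 else 0) *\<^sub>R tie_mean k v f j) = N *\<^sub>R tie_mean k v f i"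
    unfolding N_def scaleR_sum_left by (intro sum.cong) (auto intro: tie_mean_cong)
  also have "\<dots> = (\<Sum>j<k. (if v j = v i then 1 else 0) *\<^sub>R f j)"
    using tie_count_ge_1[OF assms, of v] by (simp add: tie_mean_def N_def)
  finally show ?thesis
    by (simp add: scaleR_diff_right sum_subtractf)
qed

lemma norm_tie_mean_le:
  fixes f :: "nat \<Rightarrow> 'b::real_normed_vector"
  assumes "i < k" "\<And>j. j < k \<Longrightarrow> norm (f j) \<le> G"
  shows "norm (tie_mean k v f i) \<le> G"
proof -
  define N where "N = (\<Sum>j<k. if v j = v i then 1 else 0 :: real)"
  have "norm (\<Sum>j<k. (if v j = v i then 1 else 0) *\<^sub>R f j) \<le> (\<Sum>j<k. (if v j = v i then 1 else 0) * G)"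
    by (intro order_trans[OF norm_sum sum_mono]) (auto simp: assms)
  also have "\<dots> = N * G"
    by (simp add: N_def sum_distrib_right)
  finally show ?thesis
    using tie_count_ge_1[OF assms(1), of v]
    by (simp add: tie_mean_def field_simps flip: N_def)
qed

lemma tie_mean_nonneg:
  fixes f :: "nat \<Rightarrow> real"
  assumes "\<And>j. j < k \<Longrightarrow> 0 \<le> f j"
  shows "0 \<le> tie_mean k v f i"
  using assms by (auto simp: tie_mean_def intro!: mult_nonneg_nonneg sum_nonneg)

lemma tie_mean_less_imp:
  fixes f :: "nat \<Rightarrow> real"
  assumes "i < k" "tie_mean k v f i < c"
  shows "\<exists>j<k. v j = v i \<and> f j < c"
proof (rule ccontr)
  assume "\<not> ?thesis"
  then have "(\<Sum>j<k. if v j = v i then 1 else 0) * c \<le> (\<Sum>j<k. (if v j = v i then 1 else 0) *\<^sub>R f j)"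
    unfolding sum_distrib_right by (intro sum_mono) auto
  then have "c \<le> tie_mean k v f i"
    using tie_count_ge_1[OF assms(1), of v]
    unfolding tie_mean_def by (simp add: pos_le_divide_eq mult.commute[of c] flip: divide_inverse_commute)
  then show False using assms by simp
qed

lemma tie_mean_greater_imp:
  fixes f :: "nat \<Rightarrow> real"
  assumes "i < k" "c < tie_mean k v f i"
  shows "\<exists>j<k. v j = v i \<and> c < f j"
proof -
  have "tie_mean k v (\<lambda>j. - f j) i = - tie_mean k v f i"
    by (simp add: tie_mean_def sum_negf)
  then show ?thesis
    using tie_mean_less_imp[of i k v "\<lambda>j. - f j" "- c"] assms by auto
qed

lemma tie_mean_transpose:
  assumes "v a = v b" "a < k" "b < k"
  shows "tie_mean k v (\<lambda>j. f (Transposition.transpose a b j)) i = tie_mean k v f i"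
proof -
  have v: "v (Transposition.transpose a b j) = v j" for j
    using assms by (auto simp: Transposition.transpose_def)
  have "(\<Sum>j<k. (if v j = v i then 1 else 0) *\<^sub>R f (Transposition.transpose a b j))
      = (\<Sum>j<k. (if v j = v i then 1 else 0) *\<^sub>R f j)"
    by (rule sum.reindex_bij_witness[of _ "Transposition.transpose a b" "Transposition.transpose a b"])
       (use assms in \<open>auto simp: v\<close>, auto simp: Transposition.transpose_def)
  then show ?thesis
    by (simp add: tie_mean_def)
qed

section \<open>Weight vectors\<close>

lemma weight_simplex_le_1:
  assumes "w \<in> weight_simplex k" "i < k"
  shows "w i \<le> 1"
  using assms member_le_sum[of i "{..<k}" w] by (auto simp: weight_simplex_def)

lemma norm_weighted_sum_le:
  fixes y :: "nat \<Rightarrow> 'b::real_normed_vector"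
  assumes "w \<in> weight_simplex k" "\<And>i. i < k \<Longrightarrow> norm (y i) \<le> L"
  shows "norm (\<Sum>i<k. w i *\<^sub>R y i) \<le> L"
proof -
  have "norm (\<Sum>i<k. w i *\<^sub>R y i) \<le> (\<Sum>i<k. w i * L)"
    by (intro order_trans[OF norm_sum sum_mono])
       (use assms in \<open>auto simp: weight_simplex_def intro!: mult_left_mono\<close>)
  then show ?thesis
    using assms(1) by (simp add: weight_simplex_def flip: sum_distrib_right)
qed

text \<open>
  The weights \<open>w\<close> belong to a full sample and \<open>w'\<close> to its two halves. On either half \<open>w - w'\<close> has one sign, up to
  indices that share the same vector, so its contribution is controlled by the total of \<open>w - w'\<close> there. Both
  totals are the excess of mass that \<open>w\<close> puts on the first half, up to sign.
\<close>

lemma norm_half_difference_le: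
  fixes y :: "nat \<Rightarrow> 'b::real_normed_vector"
  assumes sum: "(\<Sum>i<2 * h. w i) = 1" "(\<Sum>i<h. w' i) = 1 / 2" "(\<Sum>i<h. w' (i + h)) = 1 / 2"
    and cross: "\<And>i j. i < 2 * h \<Longrightarrow> j < 2 * h \<Longrightarrow> i < h \<longleftrightarrow> j < h \<Longrightarrow>
          w' i < w i \<Longrightarrow> w j < w' j \<Longrightarrow> y i = y j"
    and bound: "\<And>i. i < 2 * h \<Longrightarrow> norm (y i) \<le> G"
  shows "norm (\<Sum>i<2 * h. (w i - w' i) *\<^sub>R y i) \<le> 2 * G * \<bar>(\<Sum>i<h. w i) - 1 / 2\<bar>"
proof -
  have "norm (\<Sum>i<h. (w i - w' i) *\<^sub>R y i) \<le> G * \<bar>\<Sum>i<h. (w i - w' i)\<bar>"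
    by (rule norm_sum_one_sign_le) (use cross bound in auto)
  moreover have "norm (\<Sum>i<h. (w (i + h) - w' (i + h)) *\<^sub>R y (i + h))
      \<le> G * \<bar>\<Sum>i<h. (w (i + h) - w' (i + h))\<bar>"
    by (rule norm_sum_one_sign_le) (use cross bound in auto)
  moreover have "(\<Sum>i<h. w (i + h)) = 1 - (\<Sum>i<h. w i)"
    using sum(1) by (simp add: sum_lessThan_double)
  then have "\<bar>\<Sum>i<h. (w (i + h) - w' (i + h))\<bar> = \<bar>(\<Sum>i<h. w i) - 1 / 2\<bar>"
    using sum by (simp add: sum_subtractf)
  moreover have "\<bar>\<Sum>i<h. (w i - w' i)\<bar> = \<bar>(\<Sum>i<h. w i) - 1 / 2\<bar>"
    using sum by (simp add: sum_subtractf)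
  ultimately show ?thesis
    using norm_triangle_ineq[of "\<Sum>i<h. (w i - w' i) *\<^sub>R y i"
        "\<Sum>i<h. (w (i + h) - w' (i + h)) *\<^sub>R y (i + h)"]
    by (simp add: sum_lessThan_double)
qed

lemma sum_power2_le_cap:
  assumes "w \<in> weight_simplex k" "\<And>i. i < k \<Longrightarrow> w i \<le> c"
  shows "(\<Sum>i<k. (w i)\<^sup>2) \<le> c"
proof -
  have "(\<Sum>i<k. (w i)\<^sup>2) \<le> (\<Sum>i<k. w i * c)"
    unfolding power2_eq_square using assms
    by (intro sum_mono mult_left_mono) (auto simp: weight_simplex_def)
  then show ?thesis
    using assms by (simp add: weight_simplex_def flip: sum_distrib_right)
qed

text \<open>
  This replaces uniqueness of the maximiser: the optimality conditions force two candidates to cross only at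
  ties, and weights that are constant on ties cannot cross there.
\<close>

lemma weights_unique:
  fixes w w' :: "nat \<Rightarrow> real"
  assumes sum: "(\<Sum>i<k. w i) = (\<Sum>i<k. w' i)"
    and cross: "\<And>i j. i < k \<Longrightarrow> j < k \<Longrightarrow> w' i < w i \<Longrightarrow> w j < w' j \<Longrightarrow> v i = v j"
    and ties: "\<And>i j. i < k \<Longrightarrow> j < k \<Longrightarrow> v i = v j \<Longrightarrow> w i = w j"
    and ties': "\<And>i j. i < k \<Longrightarrow> j < k \<Longrightarrow> v i = v j \<Longrightarrow> w' i = w' j"
    and "i < k"
  shows "w i = w' i"
proof (rule ccontr)
  assume ne: "w i \<noteq> w' i"
  have "\<exists>i<k. w' i < w i"
  proof (rule ccontr)
    assume "\<not> ?thesis"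
    then have "(\<Sum>i<k. w i) < (\<Sum>i<k. w' i)"
      using ne \<open>i < k\<close> by (intro sum_strict_mono_ex1) (auto, force+)
    then show False using sum by simp
  qed
  moreover have "\<exists>i<k. w i < w' i"
  proof (rule ccontr)
    assume "\<not> ?thesis"
    then have "(\<Sum>i<k. w' i) < (\<Sum>i<k. w i)"
      using ne \<open>i < k\<close> by (intro sum_strict_mono_ex1) (auto, force+)
    then show False using sum by simp
  qed
  ultimately obtain a b where ab: "a < k" "b < k" "w' a < w a" "w b < w' b"
    by blast
  then have "v a = v b" using cross by blast
  then show False using ties[of a b] ties'[of a b] ab by simp
qed

text \<open>
  The optimality condition for CVaR: an index whose weight could grow never has a larger loss than an index
  whose weight could shrink. Restricting the condition to a subset of the indices keeps it meaningful on the
  two halves of a sample.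
\<close>

definition threshold_on :: "'i set \<Rightarrow> real \<Rightarrow> ('i \<Rightarrow> real) \<Rightarrow> ('i \<Rightarrow> real) \<Rightarrow> bool" where
  "threshold_on A c v w \<longleftrightarrow> (\<forall>i\<in>A. 0 \<le> w i \<and> w i \<le> c) \<and>
     (\<forall>i\<in>A. \<forall>j\<in>A. 0 < w i \<longrightarrow> w j < c \<longrightarrow> v j \<le> v i)"

text \<open>
  The Karush-Kuhn-Tucker condition for the penalised objective, with \<open>c = lam * k\<close>: up to a constant,
  \<open>v i - c * w i\<close> is the partial derivative of the objective in \<open>w i\<close>, and no mass can profitably be moved
  from \<open>i\<close> to \<open>j\<close>.
\<close>

definition first_order_on :: "'i set \<Rightarrow> real \<Rightarrow> ('i \<Rightarrow> real) \<Rightarrow> ('i \<Rightarrow> real) \<Rightarrow> bool" where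
  "first_order_on A c v w \<longleftrightarrow> (\<forall>i\<in>A. 0 \<le> w i) \<and>
     (\<forall>i\<in>A. \<forall>j\<in>A. 0 < w i \<longrightarrow> v j - c * w j \<le> v i - c * w i)"

lemma threshold_crossing_tied:
  assumes "threshold_on A c v w" "threshold_on A c v w'"
    and "i \<in> A" "j \<in> A" "w' i < w i" "w j < w' j"
  shows "v i = v j"
proof (rule antisym)
  have "0 < w i" "w j < c" "0 < w' j" "w' i < c"
    using assms by (force simp: threshold_on_def)+
  then show "v i \<le> v j" "v j \<le> v i"
    using assms unfolding threshold_on_def by blast+
qed

text \<open>
  Moving mass from \<open>i\<close> to \<open>j\<close> is unprofitable at \<open>w\<close> and the reverse is unprofitable at \<open>w'\<close>. Adding the two
  conditions cancels the losses and leaves \<open>w i - w' i \<le> w j - w' j\<close>.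
\<close>

lemma first_order_no_crossing:
  assumes "first_order_on A c v w" "first_order_on A c v w'" "0 < c"
    and "i \<in> A" "j \<in> A" "w' i < w i"
  shows "w' j \<le> w j"
proof (rule ccontr)
  assume less: "\<not> w' j \<le> w j"
  have "0 \<le> w' i" "0 \<le> w j"
    using assms by (auto simp: first_order_on_def)
  then have "0 < w i" "0 < w' j"
    using assms less by auto
  then have "v j - c * w j \<le> v i - c * w i" "v i - c * w' i \<le> v j - c * w' j"
    using assms unfolding first_order_on_def by blast+
  then have "c * (w' j - w j) \<le> c * (w' i - w i)"
    by (simp add: algebra_simps)
  then have "w' j - w j \<le> w' i - w i"
    using \<open>0 < c\<close> by simp
  then show False
    using assms less by simp
qed

lemma first_order_ties:
  assumes "first_order_on A c v w" "0 < c" "i \<in> A" "j \<in> A" "v i = v j"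
  shows "w i = w j"
proof -
  have le: "w i \<le> w j" if "i \<in> A" "j \<in> A" "v i = v j" for i j
  proof (cases "0 < w i")
    case True
    then have "v j - c * w j \<le> v i - c * w i"
      using assms(1) that unfolding first_order_on_def by blast
    then show ?thesis
      using that \<open>0 < c\<close> by simp
  next
    case False
    then show ?thesis
      using assms(1) that unfolding first_order_on_def by force
  qed
  show ?thesis using assms le[of i j] le[of j i] by simp
qed

lemma threshold_on_reindex:
  assumes "threshold_on A c v w" "\<And>i. i \<in> B \<Longrightarrow> p i \<in> A" "\<And>i. i \<in> B \<Longrightarrow> v (p i) = u i"
  shows "threshold_on B c u (\<lambda>i. w (p i))"
  unfolding threshold_on_def using assms(1)[unfolded threshold_on_def] assms(2,3) by metis

lemma first_order_on_reindex:
  assumes "first_order_on A c v w" "\<And>i. i \<in> B \<Longrightarrow> p i \<in> A" "\<And>i. i \<in> B \<Longrightarrow> v (p i) = u i"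
  shows "first_order_on B c u (\<lambda>i. w (p i))"
  unfolding first_order_on_def using assms(1)[unfolded first_order_on_def] assms(2,3) by metis

section \<open>Optimality conditions for the two objectives\<close>

lemma sum_transfer:
  fixes f :: "nat \<Rightarrow> real \<Rightarrow> real"
  assumes "i < k" "j < k" "i \<noteq> j"
  shows "(\<Sum>m<k. f m ((w(i := a, j := b)) m))
     = (\<Sum>m<k. f m (w m)) + (f i a - f i (w i)) + (f j b - f j (w j))"
proof -
  have "(\<Sum>m<k. f m ((w(i := a, j := b)) m) - f m (w m))
      = (\<Sum>m\<in>{i, j}. f m ((w(i := a, j := b)) m) - f m (w m))"
    using assms by (intro sum.mono_neutral_right) auto
  then show ?thesis
    using assms by (simp add: sum_subtractf)
qed

lemma weight_simplex_transfer:
  assumes "w \<in> weight_simplex k" "i < k" "j < k" "i \<noteq> j" "0 \<le> e" "e \<le> w i"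
  shows "w(i := w i - e, j := w j + e) \<in> weight_simplex k"
  using assms sum_transfer[of i k j "\<lambda>_ t. t" w "w i - e" "w j + e"]
  by (auto simp: weight_simplex_def)

lemma weighted_sum_le:
  assumes "w \<in> weight_simplex k"
  shows "(\<Sum>i<k. w i * v i) \<le> (\<Sum>i<k. \<bar>v i\<bar>)"
proof (rule sum_mono)
  fix i assume "i \<in> {..<k}"
  then have "0 \<le> w i" "w i \<le> 1"
    using assms weight_simplex_le_1[OF assms] by (auto simp: weight_simplex_def)
  have "w i * v i \<le> w i * \<bar>v i\<bar>"
    using \<open>0 \<le> w i\<close> by (intro mult_left_mono) auto
  also have "\<dots> \<le> 1 * \<bar>v i\<bar>"
    using \<open>w i \<le> 1\<close> by (intro mult_right_mono) auto
  finally show "w i * v i \<le> \<bar>v i\<bar>" by simp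
qed

lemma cvar_maximal:
  assumes "cvar_value k v w = cvar_objective \<alpha> k v" "w' \<in> cvar_weights \<alpha> k"
  shows "cvar_value k v w' \<le> cvar_value k v w"
  unfolding assms(1) cvar_objective_def
  by (rule cSUP_upper[OF assms(2)])
     (auto intro!: bdd_aboveI2 weighted_sum_le simp: cvar_value_def cvar_weights_def)

lemma chi2_maximal:
  assumes "chi2_value lam k v w = chi2_objective lam k v" "w' \<in> weight_simplex k" "0 \<le> lam"
  shows "chi2_value lam k v w' \<le> chi2_value lam k v w"
  unfolding assms(1) chi2_objective_def
proof (rule cSUP_upper[OF assms(2)])
  show "bdd_above (chi2_value lam k v ` weight_simplex k)"
  proof (rule bdd_aboveI2)
    fix w assume "w \<in> weight_simplex k"
    moreover have "0 \<le> lam / (2 * real k) * (\<Sum>i<k. (real k * w i - 1)\<^sup>2)"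
      using assms(3) by (simp add: sum_nonneg)
    ultimately show "chi2_value lam k v w \<le> (\<Sum>i<k. \<bar>v i\<bar>)"
      using weighted_sum_le[of w k v] by (simp add: chi2_value_def)
  qed
qed

lemma cvar_threshold:
  assumes w: "w \<in> cvar_weights \<alpha> k" "cvar_value k v w = cvar_objective \<alpha> k v"
    and ij: "i < k" "j < k" "0 < w i" "w j < 1 / (\<alpha> * real k)"
  shows "v j \<le> v i"
proof (cases "i = j")
  case False
  define e where "e = min (w i) (1 / (\<alpha> * real k) - w j)"
  have e: "0 < e" "e \<le> w i" "w j + e \<le> 1 / (\<alpha> * real k)"
    using ij by (auto simp: e_def)
  have "w(i := w i - e, j := w j + e) \<in> cvar_weights \<alpha> k"
    using w ij e False weight_simplex_transfer[of w k i j e]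
    by (auto simp: cvar_weights_def intro: order_trans[of _ "w i"])
  from cvar_maximal[OF w(2) this]
  have "(w i - e - w i) * v i + (w j + e - w j) * v j \<le> 0"
    using sum_transfer[OF ij(1,2) False, of "\<lambda>m t. t * v m" w "w i - e" "w j + e"]
    by (simp add: cvar_value_def algebra_simps)
  then have "e * (v j - v i) \<le> 0"
    by (simp add: algebra_simps)
  then show ?thesis
    using e by (simp add: mult_le_0_iff)
qed simp

lemma chi2_first_order:
  assumes w: "w \<in> weight_simplex k" "chi2_value lam k v w = chi2_objective lam k v"
    and lam: "0 < lam" and ij: "i < k" "j < k" "0 < w i"
  shows "v j - lam * real k * w j \<le> v i - lam * real k * w i"
proof (cases "i = j")
  case False
  define D where "D = (v j - lam * real k * w j) - (v i - lam * real k * w i)"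
  have k: "0 < real k" using ij by simp
  have D: "D \<le> lam * real k * e" if e: "0 < e" "e \<le> w i" for e
  proof -
    define f where "f m t = t * v m - lam / (2 * real k) * (real k * t - 1)\<^sup>2" for m t
    have val: "chi2_value lam k v u = (\<Sum>m<k. f m (u m))" for u
      by (simp add: chi2_value_def f_def sum_subtractf sum_distrib_left)
    \<comment> \<open>To first order in \<open>e\<close> the transfer changes the objective by \<open>e * D\<close>; the penalty adds a
        term that is quadratic in \<open>e\<close>.\<close>
    have "w(i := w i - e, j := w j + e) \<in> weight_simplex k"
      using w ij e False weight_simplex_transfer[of w k i j e] by simp
    from chi2_maximal[OF w(2) this] lam
    have "(f i (w i - e) - f i (w i)) + (f j (w j + e) - f j (w j)) \<le> 0"
      using sum_transfer[OF ij(1,2) False, of f w "w i - e" "w j + e"] unfolding val by simp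
    also have "(f i (w i - e) - f i (w i)) + (f j (w j + e) - f j (w j)) = e * (D - lam * real k * e)"
      using k by (simp add: f_def D_def power2_eq_square field_simps)
    finally show ?thesis
      using e by (simp add: mult_le_0_iff)
  qed
  have "D \<le> 0"
  proof (rule ccontr)
    assume "\<not> D \<le> 0"
    then have pos: "0 < D / (2 * lam * real k)" using lam k by simp
    define e where "e = min (w i) (D / (2 * lam * real k))"
    have "0 < e" "e \<le> w i" using pos ij by (auto simp: e_def)
    note D[OF this]
    also have "lam * real k * e \<le> lam * real k * (D / (2 * lam * real k))"
      using lam k by (intro mult_left_mono) (auto simp: e_def)
    also have "\<dots> = D / 2" using lam k by (simp add: field_simps)
    finally show False using \<open>\<not> D \<le> 0\<close> by simp
  qed
  then show ?thesis by (simp add: D_def)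
qed simp

text \<open>
  The penalty vanishes at the uniform weights, where the objective is nonnegative. So the penalty paid by a
  maximiser is at most the largest possible mean loss \<open>B\<close>. The deviation is measured from the uniform
  weights, since the sum of squares itself stays at least \<open>1 / k\<close> no matter how small \<open>B / lam\<close> is.
\<close>

lemma chi2_deviation_le:
  assumes w: "w \<in> weight_simplex k" "chi2_value lam k v w = chi2_objective lam k v"
    and lam: "0 < lam" and k: "1 \<le> k" and v: "\<And>i. i < k \<Longrightarrow> v i \<in> {0..B}"
  shows "(\<Sum>i<k. (w i - 1 / real k)\<^sup>2) \<le> 2 * B / (lam * real k)"
proof -
  have "(\<lambda>_. 1 / real k) \<in> weight_simplex k"
    using k by (simp add: weight_simplex_def)
  from chi2_maximal[OF w(2) this] lam
  have "(\<Sum>i<k. 1 / real k * v i) \<le> (\<Sum>i<k. w i * v i) - lam / (2 * real k) * (\<Sum>i<k. (real k * w i - 1)\<^sup>2)"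
    using k by (simp add: chi2_value_def)
  moreover have "0 \<le> (\<Sum>i<k. 1 / real k * v i)"
    using v by (intro sum_nonneg) auto
  moreover have "(\<Sum>i<k. w i * v i) \<le> (\<Sum>i<k. w i * B)"
    using v w(1) by (intro sum_mono mult_left_mono) (auto simp: weight_simplex_def)
  moreover have "(\<Sum>i<k. w i * B) = B"
    using w(1) by (simp add: weight_simplex_def flip: sum_distrib_right)
  moreover have "(\<Sum>i<k. (real k * w i - 1)\<^sup>2) = (real k)\<^sup>2 * (\<Sum>i<k. (w i - 1 / real k)\<^sup>2)"
    using k unfolding sum_distrib_left by (intro sum.cong) (auto simp: power2_eq_square field_simps)
  ultimately have "lam / (2 * real k) * ((real k)\<^sup>2 * (\<Sum>i<k. (w i - 1 / real k)\<^sup>2)) \<le> B"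
    by simp
  then show ?thesis
    using k lam by (simp add: power2_eq_square field_simps)
qed

lemma cvar_threshold_on:
  assumes "cvar_selection \<alpha> q" "1 \<le> k" "v \<in> {..<k} \<rightarrow>\<^sub>E UNIV"
  shows "threshold_on {..<k} (1 / (\<alpha> * real k)) v (q k v)"
proof -
  have "q k v \<in> cvar_weights \<alpha> k" "cvar_value k v (q k v) = cvar_objective \<alpha> k v"
    using assms by (auto simp: cvar_selection_def)
  then show ?thesis
    using cvar_threshold[of "q k v" \<alpha> k v]
    by (auto simp: threshold_on_def cvar_weights_def weight_simplex_def)
qed

lemma chi2_first_order_on:
  assumes "chi2_selection lam q" "0 < lam" "1 \<le> k" "v \<in> {..<k} \<rightarrow>\<^sub>E UNIV"
  shows "first_order_on {..<k} (lam * real k) v (q k v)"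
proof -
  have "q k v \<in> weight_simplex k" "chi2_value lam k v (q k v) = chi2_objective lam k v"
    using assms by (auto simp: chi2_selection_def)
  then show ?thesis
    using chi2_first_order[of "q k v" k lam v] assms(2)
    by (auto simp: first_order_on_def weight_simplex_def)
qed

section \<open>Maximisers on the two halves of a sample\<close>

text \<open>
  The average of the maximisers on the two halves, as a single weight vector on the whole sample.
\<close>

definition halves :: "(nat \<Rightarrow> (nat \<Rightarrow> real) \<Rightarrow> nat \<Rightarrow> real) \<Rightarrow> nat \<Rightarrow> (nat \<Rightarrow> real) \<Rightarrow> nat \<Rightarrow> real" where
  "halves q h v i =
     (if i < h then q h (\<lambda>j\<in>{..<h}. v j) i / 2 else q h (\<lambda>j\<in>{..<h}. v (j + h)) (i - h) / 2)"

lemma mlmc_diff_eq_halves: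
  fixes l :: "'a::euclidean_space \<Rightarrow> 's \<Rightarrow> real" and x :: 'a
  defines "v \<equiv> \<lambda>k S. \<lambda>j\<in>{..<k}. l x (S j)"
  shows "mlmc_diff q l l' x (2 * h) S =
     (\<Sum>i<2 * h. (q (2 * h) (v (2 * h) S) i - halves q h (v (2 * h) S) i) *\<^sub>R l' x (S i))"
proof -
  have restr: "(\<lambda>j\<in>{..<h}. v (2 * h) S j) = v h S"
      "(\<lambda>j\<in>{..<h}. v (2 * h) S (j + h)) = v h (\<lambda>i. S (i + h))"
    by (auto simp: v_def fun_eq_iff)
  have grad: "robust_grad q l l' x k S = (\<Sum>i<k. q k (v k S) i *\<^sub>R l' x (S i))" for k S
    by (simp add: robust_grad_def v_def)
  have "(\<Sum>i<2 * h. halves q h (v (2 * h) S) i *\<^sub>R l' x (S i))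
      = (1 / 2) *\<^sub>R (robust_grad q l l' x h S + robust_grad q l l' x h (\<lambda>i. S (i + h)))"
    by (simp add: sum_lessThan_double halves_def restr grad scaleR_sum_right scaleR_add_right)
  then show ?thesis
    by (simp add: mlmc_diff_def grad scaleR_diff_left sum_subtractf)
qed

text \<open>
  The cap on a half is twice the cap on the full sample, and averaging the two halves divides it by 2. So the
  weights satisfy the condition with the same cap as the maximiser on the full sample, to which they can thus
  be compared.
\<close>

lemma halves_threshold_on:
  assumes q: "cvar_selection \<alpha> q" and h: "1 \<le> h"
  shows "threshold_on {..<h} (1 / (\<alpha> * real (2 * h))) v (halves q h v)"
    and "threshold_on {h..<2 * h} (1 / (\<alpha> * real (2 * h))) v (halves q h v)"
proof -
  have cap: "1 / (\<alpha> * real (2 * h)) = (1 / (\<alpha> * real h)) / 2"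
    by simp
  have "threshold_on {..<h} (1 / (\<alpha> * real h)) (\<lambda>j\<in>{..<h}. v j) (q h (\<lambda>j\<in>{..<h}. v j))"
    by (rule cvar_threshold_on[OF q h]) simp
  then show "threshold_on {..<h} (1 / (\<alpha> * real (2 * h))) v (halves q h v)"
    unfolding cap threshold_on_def halves_def by auto
  have "threshold_on {..<h} (1 / (\<alpha> * real h)) (\<lambda>j\<in>{..<h}. v (j + h)) (q h (\<lambda>j\<in>{..<h}. v (j + h)))"
    by (rule cvar_threshold_on[OF q h]) simp
  note th = this[unfolded threshold_on_def]
  have "v j \<le> v i" if "i \<in> {h..<2 * h}" "j \<in> {h..<2 * h}" "0 < halves q h v i"
      "halves q h v j < (1 / (\<alpha> * real h)) / 2" for i j
  proof -
    have "i - h < h" "j - h < h"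
      using that by auto
    then show ?thesis
      using th[THEN conjunct2, rule_format, of "i - h" "j - h"] that by (simp add: halves_def)
  qed
  then show "threshold_on {h..<2 * h} (1 / (\<alpha> * real (2 * h))) v (halves q h v)"
    using th unfolding cap threshold_on_def by (auto simp: halves_def)
qed

text \<open>
  Halving the weights compensates for the halved sample size in \<open>lam * k\<close>, so the constant is the one of the
  full sample.
\<close>

lemma halves_first_order_on:
  assumes q: "chi2_selection lam q" and lam: "0 < lam" and h: "1 \<le> h"
  shows "first_order_on {..<h} (lam * real (2 * h)) v (halves q h v)"
    and "first_order_on {h..<2 * h} (lam * real (2 * h)) v (halves q h v)"
proof -
  have "first_order_on {..<h} (lam * real h) (\<lambda>j\<in>{..<h}. v j) (q h (\<lambda>j\<in>{..<h}. v j))"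
    by (rule chi2_first_order_on[OF q lam h]) simp
  then show "first_order_on {..<h} (lam * real (2 * h)) v (halves q h v)"
    unfolding first_order_on_def by (simp add: halves_def mult.assoc)
  have "first_order_on {..<h} (lam * real h) (\<lambda>j\<in>{..<h}. v (j + h)) (q h (\<lambda>j\<in>{..<h}. v (j + h)))"
    by (rule chi2_first_order_on[OF q lam h]) simp
  note th = this[unfolded first_order_on_def]
  have "v j - lam * real (2 * h) * halves q h v j \<le> v i - lam * real (2 * h) * halves q h v i"
    if "i \<in> {h..<2 * h}" "j \<in> {h..<2 * h}" "0 < halves q h v i" for i j
  proof -
    have "i - h < h" "j - h < h"
      using that by auto
    then show ?thesis
      using th[THEN conjunct2, rule_format, of "i - h" "j - h"] that
      by (simp add: halves_def mult.assoc)
  qed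
  then show "first_order_on {h..<2 * h} (lam * real (2 * h)) v (halves q h v)"
    using th unfolding first_order_on_def by (auto simp: halves_def)
qed

lemma halves_sum:
  assumes "\<And>v. v \<in> {..<h} \<rightarrow>\<^sub>E UNIV \<Longrightarrow> q h v \<in> weight_simplex h"
  shows "(\<Sum>i<h. halves q h v i) = 1 / 2" "(\<Sum>i<h. halves q h v (i + h)) = 1 / 2"
  using assms[of "\<lambda>j\<in>{..<h}. v j"] assms[of "\<lambda>j\<in>{..<h}. v (j + h)"]
  by (simp_all add: halves_def weight_simplex_def flip: sum_divide_distrib)

lemma halves_in_simplex:
  assumes "\<And>v. v \<in> {..<h} \<rightarrow>\<^sub>E UNIV \<Longrightarrow> q h v \<in> weight_simplex h"
  shows "halves q h v \<in> weight_simplex (2 * h)"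
  using assms[of "\<lambda>j\<in>{..<h}. v j"] assms[of "\<lambda>j\<in>{..<h}. v (j + h)"] halves_sum[of h q v, OF assms]
  by (auto simp: weight_simplex_def sum_lessThan_double halves_def)

section \<open>Invariant maximisers\<close>

lemma tie_mean_in_simplex:
  assumes "w \<in> weight_simplex k"
  shows "tie_mean k v w \<in> weight_simplex k"
proof -
  have "(\<Sum>i<k. w i *\<^sub>R tie_mean k v (\<lambda>_. 1 :: real) i) = (\<Sum>i<k. tie_mean k v w i *\<^sub>R 1)"
    by (rule sum_tie_mean)
  moreover have "(\<Sum>i<k. w i *\<^sub>R tie_mean k v (\<lambda>_. 1 :: real) i) = (\<Sum>i<k. w i)"
    by (intro sum.cong) (auto simp: tie_mean_eq)
  ultimately show ?thesis
    using assms by (simp add: weight_simplex_def tie_mean_nonneg)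
qed

text \<open>
  Whenever a tie average is positive, or below the cap, some weight among the ties is so as well, and that
  index has the same loss.
\<close>

lemma tie_mean_threshold_on:
  assumes "threshold_on {..<k} c v w"
  shows "threshold_on {..<k} c v (tie_mean k v w)"
proof -
  have bounds: "0 \<le> tie_mean k v w i" "tie_mean k v w i \<le> c" if "i < k" for i
    using tie_mean_nonneg[of k w v i] norm_tie_mean_le[OF that, of w c v] assms
    by (auto simp: threshold_on_def)
  have "v j \<le> v i" if ij: "i < k" "j < k" "0 < tie_mean k v w i" "tie_mean k v w j < c" for i j
  proof -
    obtain i' j' where "i' < k" "v i' = v i" "0 < w i'" "j' < k" "v j' = v j" "w j' < c"
      using tie_mean_greater_imp[OF ij(1,3)] tie_mean_less_imp[OF ij(2,4)] by blast
    then have "v j' \<le> v i'"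
      using assms[unfolded threshold_on_def, THEN conjunct2, rule_format, of i' j'] by simp
    then show ?thesis
      using \<open>v i' = v i\<close> \<open>v j' = v j\<close> by simp
  qed
  then show ?thesis
    using bounds by (auto simp: threshold_on_def)
qed

text \<open>
  Pulling the averaged weights of the permuted losses back along the permutation gives weights that meet the
  same conditions as the averaged weights of the original losses; by uniqueness they agree. The unaveraged
  selection need not be equivariant when losses are tied.
\<close>

lemma cvar_tie_mean_equivariant:
  fixes v :: "nat \<Rightarrow> real" and a b k :: nat
  defines "\<pi> \<equiv> Transposition.transpose a b"
  defines "v' \<equiv> \<lambda>j\<in>{..<k}. v (\<pi> j)"
  assumes q: "cvar_selection \<alpha> q" and v: "v \<in> {..<k} \<rightarrow>\<^sub>E UNIV"
    and k: "a < k" "b < k" "i < k"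
  shows "tie_mean k v' (q k v') i = tie_mean k v (q k v) (\<pi> i)"
proof -
  define c where "c = 1 / (\<alpha> * real k)"
  have k1: "1 \<le> k" and v': "v' \<in> {..<k} \<rightarrow>\<^sub>E UNIV"
    using k by (auto simp: v'_def)
  have \<pi>: "\<pi> j < k \<longleftrightarrow> j < k" "\<pi> (\<pi> j) = j" for j
    using k by (auto simp: \<pi>_def transpose_less)
  define w where "w = tie_mean k v (q k v)"
  define w' where "w' j = tie_mean k v' (q k v') (\<pi> j)" for j
  have simplex: "q k u \<in> weight_simplex k" if "u \<in> {..<k} \<rightarrow>\<^sub>E UNIV" for u
    using q k1 that by (auto simp: cvar_selection_def cvar_weights_def)
  have w: "threshold_on {..<k} c v w"
    unfolding w_def c_def by (intro tie_mean_threshold_on cvar_threshold_on q k1 v)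
  have "threshold_on {..<k} c v' (tie_mean k v' (q k v'))"
    unfolding c_def by (intro tie_mean_threshold_on cvar_threshold_on q k1 v')
  then have w': "threshold_on {..<k} c v w'"
    unfolding w'_def by (rule threshold_on_reindex) (auto simp: \<pi> v'_def)
  have "w' (\<pi> i) = w (\<pi> i)"
  proof (rule weights_unique)
    have "(\<Sum>j<k. w' j) = (\<Sum>j<k. tie_mean k v' (q k v') j)"
      unfolding w'_def \<pi>_def by (rule sum_transpose[OF k(1,2)])
    then show "(\<Sum>j<k. w' j) = (\<Sum>j<k. w j)"
      using tie_mean_in_simplex[OF simplex[OF v], of v] tie_mean_in_simplex[OF simplex[OF v'], of v']
      by (simp add: weight_simplex_def w_def)
    show "v i = v j" if "i < k" "j < k" "w i < w' i" "w' j < w j" for i j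
      using threshold_crossing_tied[OF w' w] that by auto
    show "w i = w j" if "i < k" "j < k" "v i = v j" for i j
      unfolding w_def using that by (intro tie_mean_cong)
    show "w' i = w' j" if "i < k" "j < k" "v i = v j" for i j
      unfolding w'_def using that by (intro tie_mean_cong) (simp add: v'_def \<pi>)
    show "\<pi> i < k" using k \<pi> by simp
  qed
  then show ?thesis
    by (simp add: w_def w'_def \<pi>)
qed

lemma chi2_equivariant:
  fixes v :: "nat \<Rightarrow> real" and a b k :: nat
  defines "\<pi> \<equiv> Transposition.transpose a b"
  defines "v' \<equiv> \<lambda>j\<in>{..<k}. v (\<pi> j)"
  assumes q: "chi2_selection lam q" and lam: "0 < lam" and v: "v \<in> {..<k} \<rightarrow>\<^sub>E UNIV"
    and k: "a < k" "b < k" "i < k"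
  shows "q k v' i = q k v (\<pi> i)"
proof -
  have k1: "1 \<le> k" and v': "v' \<in> {..<k} \<rightarrow>\<^sub>E UNIV"
    using k by (auto simp: v'_def)
  have \<pi>: "\<pi> j < k \<longleftrightarrow> j < k" "\<pi> (\<pi> j) = j" for j
    using k by (auto simp: \<pi>_def transpose_less)
  define c where "c = lam * real k"
  have c: "0 < c" using lam k by (simp add: c_def)
  define w where "w = q k v"
  define w' where "w' j = q k v' (\<pi> j)" for j
  have simplex: "q k u \<in> weight_simplex k" if "u \<in> {..<k} \<rightarrow>\<^sub>E UNIV" for u
    using q k1 that by (auto simp: chi2_selection_def)
  have w: "first_order_on {..<k} c v w"
    unfolding w_def c_def by (intro chi2_first_order_on q k1 v lam)
  have "first_order_on {..<k} c v' (q k v')"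
    unfolding c_def by (intro chi2_first_order_on q k1 v' lam)
  then have w': "first_order_on {..<k} c v w'"
    unfolding w'_def by (rule first_order_on_reindex) (auto simp: \<pi> v'_def)
  have "w' (\<pi> i) = w (\<pi> i)"
  proof (rule weights_unique)
    have "(\<Sum>j<k. w' j) = (\<Sum>j<k. q k v' j)"
      unfolding w'_def \<pi>_def by (rule sum_transpose[OF k(1,2)])
    then show "(\<Sum>j<k. w' j) = (\<Sum>j<k. w j)"
      using simplex[OF v] simplex[OF v'] by (simp add: weight_simplex_def w_def)
    show "v i = v j" if "i < k" "j < k" "w i < w' i" "w' j < w j" for i j
      using first_order_no_crossing[OF w' w c, of i j] that by auto
    show "w i = w j" if "i < k" "j < k" "v i = v j" for i j
      using first_order_ties[OF w c, of i j] that by auto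
    show "w' i = w' j" if "i < k" "j < k" "v i = v j" for i j
      using first_order_ties[OF w' c, of i j] that by auto
    show "\<pi> i < k" using k \<pi> by simp
  qed
  then show ?thesis
    by (simp add: w_def w'_def \<pi>)
qed

section \<open>Exchangeability of an i.i.d. sample\<close>

lemma (in prob_space) integrable_norm_power2:
  fixes F :: "'a \<Rightarrow> 'b::{real_normed_vector, second_countable_topology}"
  assumes "F \<in> borel_measurable M" "\<And>S. S \<in> space M \<Longrightarrow> norm (F S) \<le> K"
  shows "integrable M (\<lambda>S. (norm (F S))\<^sup>2)"
  using assms(1) power_mono[OF assms(2), of _ 2]
  by (intro integrable_const_bound[of _ "K\<^sup>2"] AE_I2) auto

text \<open>
  At a fixed point \<open>x\<close> a sample point enters only through its loss, here the label \<open>f\<close>, and its subgradient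
  \<open>g\<close>.
\<close>

locale labelled_sample = prob_space M
  for M :: "'s measure" +
  fixes f :: "'s \<Rightarrow> real" and g :: "'s \<Rightarrow> 'a::euclidean_space" and G :: real
  assumes f_measurable [measurable]: "f \<in> borel_measurable M"
    and g_measurable [measurable]: "g \<in> borel_measurable M"
    and g_bound: "\<And>s. s \<in> space M \<Longrightarrow> norm (g s) \<le> G"
begin

abbreviation iid :: "(nat \<Rightarrow> 's) measure" where
  "iid \<equiv> PiM UNIV (\<lambda>_. M)"

sublocale iid: prob_space iid
  by (rule prob_space_PiM) (rule prob_space_axioms)

definition labels :: "nat \<Rightarrow> (nat \<Rightarrow> 's) \<Rightarrow> nat \<Rightarrow> real" where
  "labels k S = (\<lambda>j\<in>{..<k}. f (S j))"

definition residual :: "nat \<Rightarrow> nat \<Rightarrow> (nat \<Rightarrow> 's) \<Rightarrow> 'a" where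
  "residual k i S = g (S i) - tie_mean k (labels k S) (\<lambda>j. g (S j)) i"

lemma G_nonneg: "0 \<le> G"
  using not_empty g_bound norm_ge_zero order_trans by (metis ex_in_conv)

lemma iid_component: "S \<in> space iid \<Longrightarrow> S i \<in> space M"
  by (auto simp: space_PiM PiE_iff)

lemma labels_PiE: "labels k S \<in> {..<k} \<rightarrow>\<^sub>E UNIV"
  by (auto simp: labels_def)

lemma labels_measurable [measurable]: "labels k \<in> iid \<rightarrow>\<^sub>M PiM {..<k} (\<lambda>_. borel)"
  unfolding labels_def[abs_def] by measurable

lemma label_measurable: "i < k \<Longrightarrow> (\<lambda>S. labels k S i) \<in> borel_measurable iid"
  by (simp add: labels_def)

lemma tie_measurable:
  assumes "i < k" "j < k"
  shows "Measurable.pred iid (\<lambda>S. labels k S j = labels k S i)"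
  unfolding pred_def by (intro borel_measurable_eq label_measurable assms)

lemma tie_mean_measurable:
  fixes \<phi> :: "(nat \<Rightarrow> 's) \<Rightarrow> nat \<Rightarrow> 'b::{real_normed_vector, second_countable_topology}"
  assumes "i < k" "\<And>j. j < k \<Longrightarrow> (\<lambda>S. \<phi> S j) \<in> borel_measurable iid"
  shows "(\<lambda>S. tie_mean k (labels k S) (\<phi> S) i) \<in> borel_measurable iid"
proof -
  have [measurable]: "Measurable.pred iid (\<lambda>S. labels k S j = labels k S i)" if "j < k" for j
    using tie_measurable assms(1) that by blast
  show ?thesis
    unfolding tie_mean_def using assms
    by (intro borel_measurable_scaleR borel_measurable_inverse borel_measurable_sum
        measurable_If) auto
qed

lemma residual_measurable:
  assumes "i < k"
  shows "residual k i \<in> borel_measurable iid"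
  unfolding residual_def[abs_def] by (intro borel_measurable_diff tie_mean_measurable assms) auto

lemma norm_residual_le:
  assumes "i < k" "S \<in> space iid"
  shows "norm (residual k i S) \<le> 2 * G"
proof -
  have g: "norm (g (S j)) \<le> G" for j
    using g_bound iid_component assms(2) by blast
  then have "norm (tie_mean k (labels k S) (\<lambda>j. g (S j)) i) \<le> G"
    by (rule norm_tie_mean_le[OF assms(1)])
  then show ?thesis
    using norm_triangle_ineq4[of "g (S i)" "tie_mean k (labels k S) (\<lambda>j. g (S j)) i"] g[of i]
    by (simp add: residual_def)
qed

lemma iid_integrable:
  fixes F :: "(nat \<Rightarrow> 's) \<Rightarrow> 'b::{banach, second_countable_topology}"
  assumes "F \<in> borel_measurable iid" "\<And>S. S \<in> space iid \<Longrightarrow> norm (F S) \<le> K"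
  shows "integrable iid F"
  using assms by (intro iid.integrable_const_bound[of _ K] AE_I2) auto

lemma iid_integral_le:
  fixes F :: "(nat \<Rightarrow> 's) \<Rightarrow> real"
  assumes "\<And>S. S \<in> space iid \<Longrightarrow> F S \<le> K" "integrable iid F"
  shows "(\<integral>S. F S \<partial>iid) \<le> K"
  using assms by (intro iid.integral_le_const AE_I2) auto

lemma swap_measurable [measurable]: "(\<lambda>S. S \<circ> Transposition.transpose a b) \<in> iid \<rightarrow>\<^sub>M iid"
  unfolding comp_def
  by (rule measurable_PiM_single') (auto simp: space_PiM)

lemma iid_integral_swap:
  fixes F :: "(nat \<Rightarrow> 's) \<Rightarrow> real"
  assumes [measurable]: "F \<in> borel_measurable iid"
  shows "(\<integral>S. F (S \<circ> Transposition.transpose a b) \<partial>iid) = (\<integral>S. F S \<partial>iid)"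
proof -
  have "distr iid iid (\<lambda>S. S \<circ> Transposition.transpose a b) = iid"
    using distr_PiM_reindex[of UNIV "\<lambda>_. M" "Transposition.transpose a b" UNIV] prob_space_axioms
    by (simp add: comp_def restrict_def[of _ UNIV])
  then show ?thesis
    using integral_distr[of "\<lambda>S. S \<circ> Transposition.transpose a b" iid iid F] by simp
qed

text \<open>
  Nonpositive rather than vanishing correlations suffice for this half of the Pythagorean identity. This matters
  for residuals about a tie average, which are negatively correlated.
\<close>

lemma integral_norm_sum_power2:
  fixes U :: "'i \<Rightarrow> (nat \<Rightarrow> 's) \<Rightarrow> 'b::euclidean_space"
  assumes "finite A"
    and meas: "\<And>i. i \<in> A \<Longrightarrow> U i \<in> borel_measurable iid"
    and bound: "\<And>i S. i \<in> A \<Longrightarrow> S \<in> space iid \<Longrightarrow> norm (U i S) \<le> K"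
    and cross: "\<And>i j. i \<in> A \<Longrightarrow> j \<in> A \<Longrightarrow> i \<noteq> j \<Longrightarrow> (\<integral>S. U i S \<bullet> U j S \<partial>iid) \<le> 0"
  shows "(\<integral>S. (norm (\<Sum>i\<in>A. U i S))\<^sup>2 \<partial>iid) \<le> (\<integral>S. (\<Sum>i\<in>A. (norm (U i S))\<^sup>2) \<partial>iid)"
proof -
  have int: "integrable iid (\<lambda>S. U i S \<bullet> U j S)" if "i \<in> A" "j \<in> A" for i j
  proof (rule iid_integrable)
    show "(\<lambda>S. U i S \<bullet> U j S) \<in> borel_measurable iid"
      using meas that by (intro borel_measurable_inner)
    fix S assume S: "S \<in> space iid"
    have "norm (U i S \<bullet> U j S) \<le> norm (U i S) * norm (U j S)"
      using Cauchy_Schwarz_ineq2[of "U i S" "U j S"] by simp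
    also have "\<dots> \<le> K * K"
      using bound[OF that(1) S] bound[OF that(2) S]
      by (intro mult_mono) (auto intro: order_trans[OF norm_ge_zero])
    finally show "norm (U i S \<bullet> U j S) \<le> K * K" .
  qed
  have "(\<integral>S. (norm (\<Sum>i\<in>A. U i S))\<^sup>2 \<partial>iid) = (\<integral>S. (\<Sum>i\<in>A. \<Sum>j\<in>A. U i S \<bullet> U j S) \<partial>iid)"
    by (simp add: power2_norm_eq_inner inner_sum_left inner_sum_right) (subst sum.swap, simp)
  also have "\<dots> = (\<Sum>i\<in>A. \<Sum>j\<in>A. \<integral>S. U i S \<bullet> U j S \<partial>iid)"
    using int by simp
  also have "\<dots> \<le> (\<Sum>i\<in>A. \<Sum>j\<in>A. if j = i then \<integral>S. U i S \<bullet> U i S \<partial>iid else 0)"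
    using cross by (intro sum_mono) auto
  also have "\<dots> = (\<Sum>i\<in>A. \<integral>S. U i S \<bullet> U i S \<partial>iid)"
    using \<open>finite A\<close> by simp
  also have "\<dots> = (\<integral>S. (\<Sum>i\<in>A. (norm (U i S))\<^sup>2) \<partial>iid)"
    using int by (simp add: power2_norm_eq_inner)
  finally show ?thesis .
qed

text \<open>
  With total mass 1, the excess on the first half is half the sum of the differences \<open>W i - W (i + h)\<close>. Exchanging
  the sample points \<open>i\<close> and \<open>i + h\<close> changes the sign of exactly one difference, which makes the differences
  uncorrelated.
\<close>

lemma imbalance_second_moment_le:
  fixes W :: "(nat \<Rightarrow> 's) \<Rightarrow> nat \<Rightarrow> real"
  assumes meas: "\<And>i. i < 2 * h \<Longrightarrow> (\<lambda>S. W S i) \<in> borel_measurable iid"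
    and range: "\<And>S i. S \<in> space iid \<Longrightarrow> i < 2 * h \<Longrightarrow> W S i \<in> {0..1}"
    and sum: "\<And>S. S \<in> space iid \<Longrightarrow> (\<Sum>i<2 * h. W S i) = 1"
    and equivariant: "\<And>S m i. S \<in> space iid \<Longrightarrow> m < h \<Longrightarrow> i < 2 * h \<Longrightarrow>
      W (S \<circ> Transposition.transpose m (m + h)) i = W S (Transposition.transpose m (m + h) i)"
    and bound: "\<And>S. S \<in> space iid \<Longrightarrow> (\<Sum>i<h. (W S i - W S (i + h))\<^sup>2) \<le> K"
  shows "integrable iid (\<lambda>S. ((\<Sum>i<h. W S i) - 1 / 2)\<^sup>2) \<and>
    (\<integral>S. ((\<Sum>i<h. W S i) - 1 / 2)\<^sup>2 \<partial>iid) \<le> K / 4"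
proof (rule conjI)
  have "norm ((\<Sum>i<h. W S i) - 1 / 2) \<le> 1" if S: "S \<in> space iid" for S
  proof -
    have "0 \<le> (\<Sum>i<h. W S i)" "0 \<le> (\<Sum>i<h. W S (i + h))"
      using range[OF S] by (auto intro!: sum_nonneg)
    then show ?thesis
      using sum[OF S] by (simp add: sum_lessThan_double)
  qed
  then show "integrable iid (\<lambda>S. ((\<Sum>i<h. W S i) - 1 / 2)\<^sup>2)"
    using iid.integrable_norm_power2[of "\<lambda>S. (\<Sum>i<h. W S i) - 1 / 2" 1] meas
    by simp
  define d where "d i S = W S i - W S (i + h)" for i S
  have d_meas: "d i \<in> borel_measurable iid" if "i < h" for i
    unfolding d_def[abs_def] using meas[of i] meas[of "i + h"] that by (intro borel_measurable_diff) auto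
  have d_bound: "norm (d i S) \<le> 1" if "i < h" "S \<in> space iid" for i S
    using range[OF that(2), of i] range[OF that(2), of "i + h"] that by (auto simp: d_def)
  have "(\<integral>S. d i S \<bullet> d j S \<partial>iid) = 0" if "i < h" "j < h" "i \<noteq> j" for i j
  proof -
    have "(\<integral>S. d i S * d j S \<partial>iid)
        = (\<integral>S. d i (S \<circ> Transposition.transpose i (i + h)) * d j (S \<circ> Transposition.transpose i (i + h)) \<partial>iid)"
      by (rule iid_integral_swap[symmetric]) (intro borel_measurable_times d_meas that)
    also have "\<dots> = (\<integral>S. - (d i S * d j S) \<partial>iid)"
    proof (rule Bochner_Integration.integral_cong[OF refl])
      fix S assume S: "S \<in> space iid"
      have "d i (S \<circ> Transposition.transpose i (i + h)) = - d i S"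
        using that equivariant[OF S that(1), of i] equivariant[OF S that(1), of "i + h"]
        by (simp add: d_def)
      moreover have "d j (S \<circ> Transposition.transpose i (i + h)) = d j S"
        using that equivariant[OF S that(1), of j] equivariant[OF S that(1), of "j + h"]
        by (simp add: d_def Transposition.transpose_def)
      ultimately show "d i (S \<circ> Transposition.transpose i (i + h)) *
          d j (S \<circ> Transposition.transpose i (i + h)) = - (d i S * d j S)"
        by simp
    qed
    finally show ?thesis by simp
  qed
  then have "(\<integral>S. (norm (\<Sum>i<h. d i S))\<^sup>2 \<partial>iid) \<le> (\<integral>S. (\<Sum>i<h. (norm (d i S))\<^sup>2) \<partial>iid)"
    using d_meas d_bound by (intro integral_norm_sum_power2[of _ _ 1]) auto
  also have "\<dots> \<le> K"
  proof (rule iid_integral_le)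
    show "integrable iid (\<lambda>S. \<Sum>i<h. (norm (d i S))\<^sup>2)"
      using d_meas d_bound
      by (intro Bochner_Integration.integrable_sum iid_integrable[of _ 1])
         (auto intro!: borel_measurable_power simp: abs_square_le_1)
  qed (use bound in \<open>simp add: d_def\<close>)
  finally have le: "(\<integral>S. (\<Sum>i<h. d i S)\<^sup>2 \<partial>iid) \<le> K" by simp
  have "(\<integral>S. ((\<Sum>i<h. W S i) - 1 / 2)\<^sup>2 \<partial>iid) = (\<integral>S. (\<Sum>i<h. d i S)\<^sup>2 / 4 \<partial>iid)"
  proof (rule Bochner_Integration.integral_cong[OF refl])
    fix S assume "S \<in> space iid"
    from sum[OF this] have "(\<Sum>i<h. W S i) - 1 / 2 = (\<Sum>i<h. d i S) / 2"
      by (simp add: sum_lessThan_double d_def sum_subtractf)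
    then show "((\<Sum>i<h. W S i) - 1 / 2)\<^sup>2 = (\<Sum>i<h. d i S)\<^sup>2 / 4"
      by (simp only: power_divide) simp
  qed
  then show "(\<integral>S. ((\<Sum>i<h. W S i) - 1 / 2)\<^sup>2 \<partial>iid) \<le> K / 4"
    using le by simp
qed

lemma labels_swap:
  assumes "labels k S a = labels k S b" "a < k" "b < k"
  shows "labels k (S \<circ> Transposition.transpose a b) = labels k S"
  using assms by (auto simp: labels_def Transposition.transpose_def fun_eq_iff)

lemma residual_swap:
  assumes tie: "labels k S a = labels k S b" and k: "a < k" "b < k" "i < k"
  shows "residual k i (S \<circ> Transposition.transpose a b) = residual k (Transposition.transpose a b i) S"
proof -
  have "labels k S (Transposition.transpose a b i) = labels k S i"
    using tie by (auto simp: Transposition.transpose_def)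
  then have "tie_mean k (labels k S) (\<lambda>j. g (S j)) (Transposition.transpose a b i)
      = tie_mean k (labels k S) (\<lambda>j. g (S j)) i"
    by (rule tie_mean_cong)
  then show ?thesis
    using tie_mean_transpose[OF tie k(1,2), of "\<lambda>j. g (S j)" i]
    by (simp add: residual_def labels_swap[OF tie k(1,2)])
qed

text \<open>
  Let \<open>T\<close> be the set of indices other than \<open>j\<close> that are tied with \<open>i\<close>. Exchanging the sample points \<open>i\<close> and
  \<open>m \<in> T\<close> preserves all labels, so the residual at \<open>i\<close> may be replaced by the average of the residuals over
  \<open>T\<close>. The residuals over a full set of ties sum to zero. Hence that average is 0 if \<open>j\<close> is not tied with
  \<open>i\<close>, and a negative multiple of the residual at \<open>j\<close> if it is. The weights must be nonnegative for the sign
  to be the right one.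
\<close>

lemma residual_cross_nonpos:
  fixes w :: "(nat \<Rightarrow> real) \<Rightarrow> nat \<Rightarrow> real"
  assumes meas: "\<And>i. i < k \<Longrightarrow> (\<lambda>S. w (labels k S) i) \<in> borel_measurable iid"
    and range: "\<And>S i. S \<in> space iid \<Longrightarrow> i < k \<Longrightarrow> w (labels k S) i \<in> {0..1}"
    and ij: "i < k" "j < k" "i \<noteq> j"
  shows "(\<integral>S. (w (labels k S) i *\<^sub>R residual k i S) \<bullet> (w (labels k S) j *\<^sub>R residual k j S) \<partial>iid) \<le> 0"
proof -
  define c where "c S m = w (labels k S) i * w (labels k S) j * (residual k m S \<bullet> residual k j S)" for S m
  \<comment> \<open>\<open>e S\<close> is the indicator function of \<open>T\<close>, and \<open>n S\<close> the size of \<open>T\<close>.\<close>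
  define e :: "(nat \<Rightarrow> 's) \<Rightarrow> nat \<Rightarrow> real" where
    "e S m = (if labels k S m = labels k S i \<and> m \<noteq> j then 1 else 0)" for S m
  define n where "n S = (\<Sum>m<k. e S m)" for S
  have n1: "1 \<le> n S" for S
  proof -
    have "e S i \<le> n S"
      unfolding n_def by (rule member_le_sum) (use ij in \<open>auto simp: e_def\<close>)
    then show ?thesis using ij by (simp add: e_def)
  qed
  have c_meas [measurable]: "(\<lambda>S. c S m) \<in> borel_measurable iid" if "m < k" for m
    unfolding c_def using meas residual_measurable that ij
    by (intro borel_measurable_times borel_measurable_inner) auto
  have e_meas [measurable]: "(\<lambda>S. e S m) \<in> borel_measurable iid" if "m < k" for m
  proof -
    have [measurable]: "Measurable.pred iid (\<lambda>S. labels k S m = labels k S i)"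
      using tie_measurable ij(1) that by blast
    show ?thesis unfolding e_def by measurable
  qed
  have n_meas [measurable]: "n \<in> borel_measurable iid"
    unfolding n_def[abs_def] by (intro borel_measurable_sum e_meas) auto
  have c_bound: "\<bar>c S m\<bar> \<le> 4 * G\<^sup>2" if "S \<in> space iid" "m < k" for S m
  proof -
    have "\<bar>residual k m S \<bullet> residual k j S\<bar> \<le> norm (residual k m S) * norm (residual k j S)"
      by (rule Cauchy_Schwarz_ineq2)
    also have "\<dots> \<le> (2 * G) * (2 * G)"
      using norm_residual_le that ij G_nonneg by (intro mult_mono) auto
    finally have "\<bar>residual k m S \<bullet> residual k j S\<bar> \<le> 4 * G\<^sup>2"
      by (simp add: power2_eq_square)
    moreover have "\<bar>w (labels k S) i * w (labels k S) j\<bar> \<le> 1 * 1"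
      using range[OF that(1), of i] range[OF that(1), of j] ij unfolding abs_mult
      by (intro mult_mono) auto
    ultimately have "\<bar>w (labels k S) i * w (labels k S) j\<bar> * \<bar>residual k m S \<bullet> residual k j S\<bar>
        \<le> 1 * (4 * G\<^sup>2)"
      by (intro mult_mono) auto
    then show ?thesis
      by (simp add: c_def abs_mult)
  qed
  have e01: "e S m \<in> {0, 1}" for S m by (auto simp: e_def)
  have int: "integrable iid (\<lambda>S. e S m / n S * c S a)" if "m < k" "a < k" for m a
  proof (rule iid_integrable)
    show "(\<lambda>S. e S m / n S * c S a) \<in> borel_measurable iid"
      using that by measurable
    fix S assume S: "S \<in> space iid"
    have "\<bar>e S m / n S\<bar> * \<bar>c S a\<bar> \<le> 1 * (4 * G\<^sup>2)"
      using c_bound[OF S that(2)] n1[of S] e01[of S m] by (intro mult_mono) auto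
    then show "norm (e S m / n S * c S a) \<le> 4 * G\<^sup>2"
      by (simp add: abs_mult)
  qed
  have "(\<integral>S. c S i \<partial>iid) = (\<integral>S. (\<Sum>m<k. e S m / n S * c S i) \<partial>iid)"
  proof (rule Bochner_Integration.integral_cong[OF refl])
    fix S
    have "(\<Sum>m<k. e S m / n S * c S i) = n S / n S * c S i"
      unfolding sum_distrib_right[symmetric] sum_divide_distrib[symmetric] n_def ..
    then show "c S i = (\<Sum>m<k. e S m / n S * c S i)"
      using n1[of S] by simp
  qed
  also have "\<dots> = (\<Sum>m<k. \<integral>S. e S m / n S * c S i \<partial>iid)"
    using int ij by simp
  also have "\<dots> = (\<Sum>m<k. \<integral>S. e S m / n S * c S m \<partial>iid)"
  proof (rule sum.cong[OF refl])
    fix m assume "m \<in> {..<k}"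
    then have m: "m < k" by simp
    let ?\<tau> = "\<lambda>S. S \<circ> Transposition.transpose i m"
    have "(\<integral>S. e S m / n S * c S i \<partial>iid) = (\<integral>S. e (?\<tau> S) m / n (?\<tau> S) * c (?\<tau> S) i \<partial>iid)"
      using m ij by (intro iid_integral_swap[symmetric]) measurable
    also have "\<dots> = (\<integral>S. e S m / n S * c S m \<partial>iid)"
    proof (rule Bochner_Integration.integral_cong[OF refl])
      fix S
      show "e (?\<tau> S) m / n (?\<tau> S) * c (?\<tau> S) i = e S m / n S * c S m"
      proof (cases "labels k S i = labels k S m \<and> m \<noteq> j")
        case True
        then have L: "labels k (?\<tau> S) = labels k S"
          using labels_swap m ij by blast
        moreover have "residual k i (?\<tau> S) = residual k m S" "residual k j (?\<tau> S) = residual k j S"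
          using True m ij residual_swap[of k S i m i] residual_swap[of k S i m j] by auto
        moreover have "e (?\<tau> S) = e S"
          by (simp add: e_def L fun_eq_iff)
        ultimately show ?thesis
          by (simp add: c_def n_def)
      next
        case False
        then show ?thesis
          using m ij by (auto simp: e_def labels_def)
      qed
    qed
    finally show "(\<integral>S. e S m / n S * c S i \<partial>iid) = (\<integral>S. e S m / n S * c S m \<partial>iid)" .
  qed
  also have "\<dots> = (\<integral>S. (\<Sum>m<k. e S m / n S * c S m) \<partial>iid)"
    using int by simp
  also have "\<dots> \<le> 0"
  proof (rule iid_integral_le)
    show "integrable iid (\<lambda>S. \<Sum>m<k. e S m / n S * c S m)"
      by (intro Bochner_Integration.integrable_sum int) auto
    fix S assume S: "S \<in> space iid"
    have "(\<Sum>m<k. e S m *\<^sub>R residual k m S)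
        = (\<Sum>m<k. (if labels k S m = labels k S i then 1 else 0) *\<^sub>R residual k m S)
          - (\<Sum>m<k. if m = j then (if labels k S j = labels k S i then residual k j S else 0) else 0)"
      unfolding sum_subtractf[symmetric] by (intro sum.cong) (auto simp: e_def)
    also have "\<dots> = - (if labels k S j = labels k S i then residual k j S else 0)"
      using sum_minus_tie_mean_eq_0[OF ij(1), of "labels k S" "\<lambda>m. g (S m)"] ij
      by (simp add: residual_def)
    finally have "(\<Sum>m<k. e S m *\<^sub>R residual k m S) \<bullet> residual k j S \<le> 0"
      by simp
    moreover have "(\<Sum>m<k. e S m / n S * c S m) = w (labels k S) i * w (labels k S) j / n S
          * ((\<Sum>m<k. e S m *\<^sub>R residual k m S) \<bullet> residual k j S)"
      by (simp add: c_def inner_sum_left sum_distrib_left ac_simps)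
    moreover have "0 \<le> w (labels k S) i * w (labels k S) j / n S"
      using range[OF S, of i] range[OF S, of j] ij n1[of S] by simp
    ultimately show "(\<Sum>m<k. e S m / n S * c S m) \<le> 0"
      by (simp only: mult_nonneg_nonpos)
  qed
  finally show ?thesis
    by (simp add: c_def ac_simps)
qed

text \<open>
  The weights depend on the sample through the labels only. For weights that could see \<open>g\<close> the residuals
  could all be aligned, and the bound would fail.
\<close>

lemma residual_sum_second_moment_le:
  fixes w :: "(nat \<Rightarrow> real) \<Rightarrow> nat \<Rightarrow> real"
  assumes meas: "\<And>i. i < k \<Longrightarrow> (\<lambda>S. w (labels k S) i) \<in> borel_measurable iid"
    and range: "\<And>S i. S \<in> space iid \<Longrightarrow> i < k \<Longrightarrow> w (labels k S) i \<in> {0..1}"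
    and sq: "\<And>S. S \<in> space iid \<Longrightarrow> (\<Sum>i<k. (w (labels k S) i)\<^sup>2) \<le> K"
  shows "(\<integral>S. (norm (\<Sum>i<k. w (labels k S) i *\<^sub>R residual k i S))\<^sup>2 \<partial>iid) \<le> 4 * G\<^sup>2 * K"
proof -
  define U where "U i S = w (labels k S) i *\<^sub>R residual k i S" for i S
  have U_meas: "U i \<in> borel_measurable iid" if "i < k" for i
    unfolding U_def[abs_def] using meas residual_measurable that by (intro borel_measurable_scaleR) auto
  have U_le: "norm (U i S) \<le> w (labels k S) i * (2 * G)" if "i < k" "S \<in> space iid" for i S
    using norm_residual_le[OF that] range[OF that(2,1)] by (auto simp: U_def intro!: mult_left_mono)
  have U_bound: "norm (U i S) \<le> 2 * G" if "i < k" "S \<in> space iid" for i S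
    using U_le[OF that] range[OF that(2,1)] G_nonneg mult_right_mono[of "w (labels k S) i" 1 "2 * G"]
    by auto
  have "(\<integral>S. (norm (\<Sum>i<k. U i S))\<^sup>2 \<partial>iid) \<le> (\<integral>S. (\<Sum>i<k. (norm (U i S))\<^sup>2) \<partial>iid)"
    using U_meas U_bound residual_cross_nonpos[of k w, OF meas range]
    by (intro integral_norm_sum_power2[of _ _ "2 * G"]) (auto simp: U_def[abs_def])
  also have "\<dots> \<le> 4 * G\<^sup>2 * K"
  proof (rule iid_integral_le)
    show "integrable iid (\<lambda>S. \<Sum>i<k. (norm (U i S))\<^sup>2)"
      using U_meas power_mono[OF U_bound, of _ _ 2]
      by (intro Bochner_Integration.integrable_sum iid_integrable[of _ "(2 * G)\<^sup>2"])
         (auto intro!: borel_measurable_power borel_measurable_norm)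
    fix S assume S: "S \<in> space iid"
    have "(\<Sum>i<k. (norm (U i S))\<^sup>2) \<le> (\<Sum>i<k. (w (labels k S) i * (2 * G))\<^sup>2)"
      using U_le[OF _ S] by (intro sum_mono power_mono) auto
    also have "\<dots> = 4 * G\<^sup>2 * (\<Sum>i<k. (w (labels k S) i)\<^sup>2)"
      by (simp add: power_mult_distrib sum_distrib_left mult.commute)
    also have "\<dots> \<le> 4 * G\<^sup>2 * K"
      using sq[OF S] by (intro mult_left_mono) auto
    finally show "(\<Sum>i<k. (norm (U i S))\<^sup>2) \<le> 4 * G\<^sup>2 * K" .
  qed
  finally show ?thesis by (simp add: U_def)
qed

end

section \<open>Second moments of the level differences\<close>

context labelled_sample
begin

lemma labels_comp_transpose:
  assumes "a < k" "b < k"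
  shows "labels k (S \<circ> Transposition.transpose a b) =
    (\<lambda>j\<in>{..<k}. labels k S (Transposition.transpose a b j))"
  using assms by (auto simp: labels_def fun_eq_iff transpose_less)

lemma selection_measurable:
  assumes "measurable_selection q" "i < k" "(\<lambda>S. u S) \<in> iid \<rightarrow>\<^sub>M PiM {..<k} (\<lambda>_. borel)"
  shows "(\<lambda>S. q k (u S) i) \<in> borel_measurable iid"
proof -
  have "(\<lambda>v. q k v i) \<in> borel_measurable (PiM {..<k} (\<lambda>_. borel))"
    using assms by (simp add: measurable_selection_def)
  from measurable_compose[OF assms(3) this] show ?thesis .
qed

lemma halves_measurable:
  assumes "measurable_selection q" "i < 2 * h"
  shows "(\<lambda>S. halves q h (labels (2 * h) S) i) \<in> borel_measurable iid"
proof (cases "i < h")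
  case True
  have "(\<lambda>S. \<lambda>j\<in>{..<h}. labels (2 * h) S j) \<in> iid \<rightarrow>\<^sub>M PiM {..<h} (\<lambda>_. borel)"
    by (intro measurable_restrict label_measurable) auto
  from selection_measurable[OF assms(1) True this] show ?thesis
    using True by (simp add: halves_def)
next
  case False
  have "(\<lambda>S. \<lambda>j\<in>{..<h}. labels (2 * h) S (j + h)) \<in> iid \<rightarrow>\<^sub>M PiM {..<h} (\<lambda>_. borel)"
    by (intro measurable_restrict label_measurable) auto
  moreover have "i - h < h"
    using False assms by auto
  ultimately have "(\<lambda>S. q h (\<lambda>j\<in>{..<h}. labels (2 * h) S (j + h)) (i - h)) \<in> borel_measurable iid"
    using selection_measurable[OF assms(1)] by blast
  then show ?thesis
    using False by (simp add: halves_def)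
qed

definition half_difference ::
  "(nat \<Rightarrow> (nat \<Rightarrow> real) \<Rightarrow> nat \<Rightarrow> real) \<Rightarrow> nat \<Rightarrow> (nat \<Rightarrow> 's) \<Rightarrow> 'a" where
  "half_difference q h S = (\<Sum>i<2 * h.
     (q (2 * h) (labels (2 * h) S) i - halves q h (labels (2 * h) S) i) *\<^sub>R g (S i))"

lemma half_difference_measurable:
  assumes "measurable_selection q"
  shows "half_difference q h \<in> borel_measurable iid"
  unfolding half_difference_def[abs_def]
  by (intro borel_measurable_sum borel_measurable_scaleR borel_measurable_diff
      selection_measurable[OF assms _ labels_measurable] halves_measurable[OF assms]) auto

text \<open>
  The difference is split into residual sums with the weights of the full sample and of the halves, and a
  part in which \<open>g\<close> is replaced by its tie average. In the last part the selected weights may be averaged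
  over ties as well, since averaging is self-adjoint; this makes them equivariant. Each part has second moment of
  order \<open>G\<^sup>2 * c\<close> with the cap \<open>c = 1 / (\<alpha> * k)\<close>, because the squares of capped weights with sum 1 sum to at most \<open>c\<close>.
\<close>

lemma cvar_half_difference_second_moment_le:
  assumes q: "cvar_selection \<alpha> q" and h: "1 \<le> h"
  shows "(\<integral>S. (norm (half_difference q h S))\<^sup>2 \<partial>iid) \<le> 27 * G\<^sup>2 / (\<alpha> * real (2 * h))"
proof -
  define k where "k = 2 * h"
  define c where "c = 1 / (\<alpha> * real k)"
  define p where "p v = halves q h v" for v
  define W where "W S = tie_mean k (labels k S) (q k (labels k S))" for S
  define gm where "gm S = tie_mean k (labels k S) (\<lambda>j. g (S j))" for S
  define U where "U S = (\<Sum>i<k. q k (labels k S) i *\<^sub>R residual k i S)" for S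
  define V where "V S = (\<Sum>i<k. p (labels k S) i *\<^sub>R residual k i S)" for S
  define t where "t S = (\<Sum>i<h. W S i) - 1 / 2" for S
  have k: "1 \<le> k" using h by (simp add: k_def)
  have q_meas: "measurable_selection q"
    using q by (simp add: cvar_selection_def)
  have simplex: "q m v \<in> weight_simplex m" if "1 \<le> m" "v \<in> {..<m} \<rightarrow>\<^sub>E UNIV" for m v
    using q that by (auto simp: cvar_selection_def cvar_weights_def)
  have q_simplex: "q k (labels k S) \<in> weight_simplex k" for S
    using simplex k labels_PiE by blast
  have p_simplex: "p v \<in> weight_simplex k" for v
    unfolding p_def k_def using simplex[OF h] by (intro halves_in_simplex)
  have W_simplex: "W S \<in> weight_simplex k" for S
    unfolding W_def by (intro tie_mean_in_simplex q_simplex)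
  have q_th: "threshold_on {..<k} c (labels k S) (q k (labels k S))" for S
    unfolding c_def by (intro cvar_threshold_on q k labels_PiE)
  have W_th: "threshold_on {..<k} c (labels k S) (W S)" for S
    unfolding W_def by (intro tie_mean_threshold_on q_th)
  have p_th: "threshold_on {..<h} c v (p v)" "threshold_on {h..<k} c v (p v)" for v
    unfolding c_def k_def p_def by (rule halves_threshold_on[OF q h])+
  have p_le: "p v i \<le> c" if "i < k" for v i
    using p_th[of v] that by (cases "i < h") (auto simp: threshold_on_def)
  have W_meas: "(\<lambda>S. W S i) \<in> borel_measurable iid" if "i < k" for i
    unfolding W_def using that by (intro tie_mean_measurable selection_measurable[OF q_meas _ labels_measurable])
  have range: "w i \<in> {0..1}" if "w \<in> weight_simplex k" "i < k" for w i
    using that weight_simplex_le_1[OF that] by (auto simp: weight_simplex_def)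
  have U: "(\<integral>S. (norm (U S))\<^sup>2 \<partial>iid) \<le> 4 * G\<^sup>2 * c"
    unfolding U_def
  proof (rule residual_sum_second_moment_le)
    show "(\<Sum>i<k. (q k (labels k S) i)\<^sup>2) \<le> c" for S
      using q_simplex q_th[of S] by (intro sum_power2_le_cap) (auto simp: threshold_on_def)
  qed (use q_simplex range selection_measurable[OF q_meas _ labels_measurable] in blast)+
  have V: "(\<integral>S. (norm (V S))\<^sup>2 \<partial>iid) \<le> 4 * G\<^sup>2 * c"
    unfolding V_def
  proof (rule residual_sum_second_moment_le)
    show "(\<Sum>i<k. (p (labels k S) i)\<^sup>2) \<le> c" for S
      using p_simplex p_le by (intro sum_power2_le_cap)
    show "(\<lambda>S. p (labels k S) i) \<in> borel_measurable iid" if "i < k" for i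
      using halves_measurable[OF q_meas, of i h] that by (simp add: p_def k_def)
  qed (use p_simplex range in blast)
  have "integrable iid (\<lambda>S. (t S)\<^sup>2) \<and> (\<integral>S. (t S)\<^sup>2 \<partial>iid) \<le> c / 4"
    unfolding t_def
  proof (rule imbalance_second_moment_le)
    fix S m i assume m: "m < h" "i < 2 * h"
    have l: "labels k (S \<circ> Transposition.transpose m (m + h)) =
       (\<lambda>j\<in>{..<k}. labels k S (Transposition.transpose m (m + h) j))"
      using m by (intro labels_comp_transpose) (auto simp: k_def)
    show "W (S \<circ> Transposition.transpose m (m + h)) i = W S (Transposition.transpose m (m + h) i)"
      unfolding W_def l using m by (intro cvar_tie_mean_equivariant[OF q] labels_PiE) (auto simp: k_def)
  next
    fix S
    have "(\<Sum>i<h. (W S i - W S (i + h))\<^sup>2) \<le> (\<Sum>i<h. (W S i)\<^sup>2 + (W S (i + h))\<^sup>2)"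
      using W_simplex[of S] by (intro sum_mono) (auto simp: weight_simplex_def k_def power2_diff)
    also have "\<dots> = (\<Sum>i<k. (W S i)\<^sup>2)"
      by (simp add: k_def sum_lessThan_double sum.distrib)
    also have "\<dots> \<le> c"
      using W_simplex W_th[of S] by (intro sum_power2_le_cap) (auto simp: threshold_on_def)
    finally show "(\<Sum>i<h. (W S i - W S (i + h))\<^sup>2) \<le> c" .
  qed (use W_meas W_simplex range in \<open>auto simp: k_def weight_simplex_def\<close>)
  then have int_t: "integrable iid (\<lambda>S. (t S)\<^sup>2)"
    and t: "(\<integral>S. (t S)\<^sup>2 \<partial>iid) \<le> c / 4"
    by auto
  have pointwise: "(norm (half_difference q h S))\<^sup>2
      \<le> 3 * (norm (U S))\<^sup>2 + 3 * (norm (V S))\<^sup>2 + 12 * G\<^sup>2 * (t S)\<^sup>2" if S: "S \<in> space iid" for S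
  proof -
    define v where "v = labels k S"
    have "(\<Sum>i<k. W S i *\<^sub>R gm S i) = (\<Sum>i<k. q k v i *\<^sub>R tie_mean k v (gm S) i)"
      unfolding W_def v_def by (rule sum_tie_mean[symmetric])
    also have "\<dots> = (\<Sum>i<k. q k v i *\<^sub>R gm S i)"
      by (intro sum.cong refl arg_cong2[of _ _ _ _ scaleR] tie_mean_eq)
         (auto simp: gm_def v_def intro: tie_mean_cong)
    \<comment> \<open>So \<open>q\<close> may be replaced by its tie average in the part that is left once the
        residuals are split off.\<close>
    finally have "half_difference q h S = U S - V S + (\<Sum>i<k. (W S i - p v i) *\<^sub>R gm S i)"
      by (simp add: half_difference_def U_def V_def residual_def gm_def v_def p_def
          scaleR_diff_left scaleR_diff_right sum_subtractf flip: k_def)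
    moreover have "norm (\<Sum>i<2 * h. (W S i - p v i) *\<^sub>R gm S i) \<le> 2 * G * \<bar>t S\<bar>"
      unfolding t_def
    proof (rule norm_half_difference_le)
      show "(\<Sum>i<2 * h. W S i) = 1"
        using W_simplex[of S] by (simp add: weight_simplex_def k_def)
      show "(\<Sum>i<h. p v i) = 1 / 2" "(\<Sum>i<h. p v (i + h)) = 1 / 2"
        unfolding p_def using simplex[OF h] by (intro halves_sum; blast)+
      show "norm (gm S i) \<le> G" if "i < 2 * h" for i
        unfolding gm_def using that g_bound iid_component[OF S]
        by (intro norm_tie_mean_le) (auto simp: k_def)
      fix i j assume ij: "i < 2 * h" "j < 2 * h" "i < h \<longleftrightarrow> j < h" "p v i < W S i" "W S j < p v j"
      define A where "A = (if i < h then {..<h} else {h..<k})"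
      have A: "i \<in> A" "j \<in> A" "A \<subseteq> {..<k}"
        using ij by (auto simp: A_def k_def)
      have "threshold_on A c v (p v)"
        using p_th by (simp add: A_def)
      moreover have "threshold_on A c v (W S)"
        using W_th[of S] A unfolding threshold_on_def v_def by blast
      ultimately have "v i = v j"
        by (intro threshold_crossing_tied[OF _ _ A(1,2) ij(4,5)])
      then show "gm S i = gm S j"
        unfolding gm_def v_def by (rule tie_mean_cong)
    qed
    ultimately have "norm (half_difference q h S) \<le> norm (U S) + norm (V S) + 2 * G * \<bar>t S\<bar>"
      using norm_triangle_ineq[of "U S - V S" "\<Sum>i<k. (W S i - p v i) *\<^sub>R gm S i"]
        norm_triangle_ineq4[of "U S" "V S"] by (simp add: k_def)
    then have "(norm (half_difference q h S))\<^sup>2 \<le> (norm (U S) + norm (V S) + 2 * G * \<bar>t S\<bar>)\<^sup>2"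
      by (rule power_mono) simp
    also have "\<dots> \<le> 3 * (norm (U S))\<^sup>2 + 3 * (norm (V S))\<^sup>2 + 3 * (2 * G * \<bar>t S\<bar>)\<^sup>2"
    proof -
      have "(a + b + d)\<^sup>2 \<le> 3 * a\<^sup>2 + 3 * b\<^sup>2 + 3 * d\<^sup>2" for a b d :: real
        using sum_squares_ge_zero[of "a - b" "b - d"] zero_le_square[of "a - d"]
        by (simp add: power2_eq_square algebra_simps)
      then show ?thesis .
    qed
    finally show ?thesis
      by (simp add: power_mult_distrib)
  qed
  have int_U: "integrable iid (\<lambda>S. (norm (U S))\<^sup>2)" "integrable iid (\<lambda>S. (norm (V S))\<^sup>2)"
  proof -
    show "integrable iid (\<lambda>S. (norm (U S))\<^sup>2)"
      unfolding U_def using q_simplex norm_residual_le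
      by (intro iid.integrable_norm_power2[of _ "2 * G"] norm_weighted_sum_le borel_measurable_sum
          borel_measurable_scaleR residual_measurable
          selection_measurable[OF q_meas _ labels_measurable]) auto
    show "integrable iid (\<lambda>S. (norm (V S))\<^sup>2)"
      unfolding V_def using p_simplex norm_residual_le q_meas
      by (intro iid.integrable_norm_power2[of _ "2 * G"] norm_weighted_sum_le borel_measurable_sum
          borel_measurable_scaleR residual_measurable) (auto simp: p_def k_def halves_measurable)
  qed
  have "(\<integral>S. (norm (half_difference q h S))\<^sup>2 \<partial>iid)
      \<le> (\<integral>S. 3 * (norm (U S))\<^sup>2 + 3 * (norm (V S))\<^sup>2 + 12 * G\<^sup>2 * (t S)\<^sup>2 \<partial>iid)"
    using int_U int_t pointwise half_difference_measurable[OF q_meas]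
    by (intro integral_mono_AE' AE_I2) auto
  also have "\<dots> = 3 * (\<integral>S. (norm (U S))\<^sup>2 \<partial>iid) + 3 * (\<integral>S. (norm (V S))\<^sup>2 \<partial>iid)
      + 12 * G\<^sup>2 * (\<integral>S. (t S)\<^sup>2 \<partial>iid)"
    using int_U int_t by simp
  also have "\<dots> \<le> 3 * (4 * G\<^sup>2 * c) + 3 * (4 * G\<^sup>2 * c) + 12 * G\<^sup>2 * (c / 4)"
    using U V t by (intro add_mono mult_left_mono) auto
  also have "\<dots> = 27 * G\<^sup>2 / (\<alpha> * real (2 * h))"
    by (simp add: c_def k_def)
  finally show ?thesis .
qed

text \<open>
  A maximiser of the strictly concave objective is constant on ties, so it is equivariant, and the
  comparison with the maximisers on the halves needs no averaging.
\<close>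

lemma chi2_half_difference_second_moment_le:
  assumes q: "chi2_selection lam q" and lam: "0 < lam" and h: "1 \<le> h"
    and f_range: "\<And>s. s \<in> space M \<Longrightarrow> f s \<in> {0..B}"
  shows "(\<integral>S. (norm (half_difference q h S))\<^sup>2 \<partial>iid) \<le> 4 * B * G\<^sup>2 / (lam * real (2 * h))"
proof -
  define k where "k = 2 * h"
  define p where "p v = halves q h v" for v
  define W where "W S = q k (labels k S)" for S
  define t where "t S = (\<Sum>i<h. W S i) - 1 / 2" for S
  have k: "1 \<le> k" using h by (simp add: k_def)
  have q_meas: "measurable_selection q"
    using q by (simp add: chi2_selection_def)
  have simplex: "q m v \<in> weight_simplex m" if "1 \<le> m" "v \<in> {..<m} \<rightarrow>\<^sub>E UNIV" for m v
    using q that by (auto simp: chi2_selection_def)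
  have W_simplex: "W S \<in> weight_simplex k" for S
    unfolding W_def using simplex k labels_PiE by blast
  have W_fo: "first_order_on {..<k} (lam * real k) (labels k S) (W S)" for S
    unfolding W_def by (intro chi2_first_order_on q lam k labels_PiE)
  have p_fo: "first_order_on {..<h} (lam * real k) v (p v)"
      "first_order_on {h..<k} (lam * real k) v (p v)" for v
    unfolding k_def p_def by (rule halves_first_order_on[OF q lam h])+
  have W_meas: "(\<lambda>S. W S i) \<in> borel_measurable iid" if "i < k" for i
    unfolding W_def using that by (intro selection_measurable[OF q_meas _ labels_measurable])
  have range: "w i \<in> {0..1}" if "w \<in> weight_simplex k" "i < k" for w i
    using that weight_simplex_le_1[OF that] by (auto simp: weight_simplex_def)
  have "integrable iid (\<lambda>S. (t S)\<^sup>2) \<and> (\<integral>S. (t S)\<^sup>2 \<partial>iid) \<le> (4 * B / (lam * real k)) / 4"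
    unfolding t_def
  proof (rule imbalance_second_moment_le)
    fix S m i assume m: "m < h" "i < 2 * h"
    have l: "labels k (S \<circ> Transposition.transpose m (m + h)) =
       (\<lambda>j\<in>{..<k}. labels k S (Transposition.transpose m (m + h) j))"
      using m by (intro labels_comp_transpose) (auto simp: k_def)
    show "W (S \<circ> Transposition.transpose m (m + h)) i = W S (Transposition.transpose m (m + h) i)"
      unfolding W_def l using m by (intro chi2_equivariant[OF q lam] labels_PiE) (auto simp: k_def)
  next
    fix S assume S: "S \<in> space iid"
    \<comment> \<open>Only the deviation from the uniform weights is small, so both weights are compared to
        \<open>1 / k\<close>.\<close>
    have "(a - b)\<^sup>2 \<le> 2 * (a - m)\<^sup>2 + 2 * (b - m)\<^sup>2" for a b m :: real
      using zero_le_square[of "a + b - 2 * m"] by (simp add: power2_eq_square algebra_simps)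
    then have "(\<Sum>i<h. (W S i - W S (i + h))\<^sup>2)
        \<le> (\<Sum>i<h. 2 * (W S i - 1 / real k)\<^sup>2 + 2 * (W S (i + h) - 1 / real k)\<^sup>2)"
      by (intro sum_mono)
    also have "\<dots> = 2 * (\<Sum>i<k. (W S i - 1 / real k)\<^sup>2)"
      by (simp add: k_def sum_lessThan_double sum.distrib flip: sum_distrib_left)
    also have "(\<Sum>i<k. (W S i - 1 / real k)\<^sup>2) \<le> 2 * B / (lam * real k)"
    proof (rule chi2_deviation_le[OF W_simplex _ lam k])
      show "chi2_value lam k (labels k S) (W S) = chi2_objective lam k (labels k S)"
        unfolding W_def using q k labels_PiE by (auto simp: chi2_selection_def)
      show "labels k S i \<in> {0..B}" if "i < k" for i
        using f_range[OF iid_component[OF S]] that by (simp add: labels_def)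
    qed
    finally show "(\<Sum>i<h. (W S i - W S (i + h))\<^sup>2) \<le> 4 * B / (lam * real k)"
      by simp
  qed (use W_meas W_simplex range in \<open>auto simp: k_def weight_simplex_def\<close>)
  then have int_t: "integrable iid (\<lambda>S. (t S)\<^sup>2)"
    and t: "(\<integral>S. (t S)\<^sup>2 \<partial>iid) \<le> (4 * B / (lam * real k)) / 4"
    by auto
  have pointwise: "(norm (half_difference q h S))\<^sup>2 \<le> 4 * G\<^sup>2 * (t S)\<^sup>2" if S: "S \<in> space iid" for S
  proof -
    define v where "v = labels k S"
    have "norm (\<Sum>i<2 * h. (W S i - p v i) *\<^sub>R g (S i)) \<le> 2 * G * \<bar>t S\<bar>"
      unfolding t_def
    proof (rule norm_half_difference_le)
      show "(\<Sum>i<2 * h. W S i) = 1"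
        using W_simplex[of S] by (simp add: weight_simplex_def k_def)
      show "(\<Sum>i<h. p v i) = 1 / 2" "(\<Sum>i<h. p v (i + h)) = 1 / 2"
        unfolding p_def using simplex[OF h] by (intro halves_sum; blast)+
      show "norm (g (S i)) \<le> G" for i
        using g_bound iid_component[OF S] by blast
      fix i j assume ij: "i < 2 * h" "j < 2 * h" "i < h \<longleftrightarrow> j < h" "p v i < W S i" "W S j < p v j"
      define A where "A = (if i < h then {..<h} else {h..<k})"
      have A: "i \<in> A" "j \<in> A" "A \<subseteq> {..<k}"
        using ij by (auto simp: A_def k_def)
      have "first_order_on A (lam * real k) v (p v)"
        using p_fo by (simp add: A_def)
      moreover have "first_order_on A (lam * real k) v (W S)"
        using W_fo[of S] A unfolding first_order_on_def v_def by blast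
      ultimately have "p v j \<le> W S j"
        using first_order_no_crossing[of A "lam * real k" v "W S" "p v" i j] A ij lam k by simp
      then show "g (S i) = g (S j)"
        using ij by simp
    qed
    then have "norm (half_difference q h S) \<le> 2 * G * \<bar>t S\<bar>"
      by (simp add: half_difference_def W_def p_def v_def k_def)
    then have "(norm (half_difference q h S))\<^sup>2 \<le> (2 * G * \<bar>t S\<bar>)\<^sup>2"
      by (rule power_mono) simp
    then show ?thesis
      by (simp add: power_mult_distrib)
  qed
  have "(\<integral>S. (norm (half_difference q h S))\<^sup>2 \<partial>iid) \<le> (\<integral>S. 4 * G\<^sup>2 * (t S)\<^sup>2 \<partial>iid)"
    using int_t pointwise by (intro integral_mono_AE' AE_I2) auto
  also have "\<dots> = 4 * G\<^sup>2 * (\<integral>S. (t S)\<^sup>2 \<partial>iid)"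
    by simp
  also have "\<dots> \<le> 4 * G\<^sup>2 * ((4 * B / (lam * real k)) / 4)"
    using t by (intro mult_left_mono) auto
  finally show ?thesis
    by (simp add: k_def mult.commute)
qed

end

section \<open>Randomisation of the level\<close>

lemma set_pmf_mlmc_level:
  assumes "1 \<le> jmax"
  shows "set_pmf (mlmc_level jmax) \<subseteq> {1..jmax}"
  using assms by (auto simp: mlmc_level_def)

lemma pmf_mlmc_level_ge:
  assumes "1 \<le> j" "j \<le> jmax"
  shows "1 / 2 ^ j \<le> pmf (mlmc_level jmax) j"
proof (cases "j < jmax")
  case True
  then show ?thesis
    using assms by (simp add: pmf_mlmc_level power_one_over)
next
  case False
  then have "j = jmax" using assms by simp
  moreover have "(1 / 2) ^ jmax \<le> (1 / 2 :: real) ^ (jmax - 1)"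
    by (rule power_decreasing) auto
  ultimately show ?thesis
    using assms by (simp add: pmf_mlmc_level power_one_over)
qed

text \<open>
  At levels of probability zero the quotient is 0 by convention, so the factor is bounded on all levels. This
  makes the estimator a bounded function.
\<close>

lemma inverse_pmf_mlmc_level_le:
  assumes "1 \<le> jmax"
  shows "1 / pmf (mlmc_level jmax) j \<le> 2 ^ jmax"
proof (cases "j \<in> {1..jmax}")
  case True
  then have "1 / 2 ^ j \<le> pmf (mlmc_level jmax) j"
    by (intro pmf_mlmc_level_ge) auto
  then have "1 / pmf (mlmc_level jmax) j \<le> 1 / (1 / 2 ^ j)"
    by (intro frac_le) auto
  also have "\<dots> \<le> 2 ^ jmax"
    using True by simp
  finally show ?thesis .
next
  case False
  then have "pmf (mlmc_level jmax) j = 0"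
    using set_pmf_mlmc_level[OF assms] by (auto simp: pmf_eq_0_set_pmf)
  then show ?thesis by simp
qed

text \<open>
  Level \<open>j\<close> has probability \<open>p \<ge> 1 / 2 ^ j\<close>, and its rescaled difference has second moment at most
  \<open>K / (2 ^ j * p\<^sup>2)\<close>. Weighted with \<open>p\<close> this is at most \<open>K\<close>, the same for each level.
\<close>

lemma (in prob_space) randomized_level_second_moment_le:
  fixes R :: "'a \<Rightarrow> 'b::euclidean_space" and D :: "nat \<Rightarrow> 'a \<Rightarrow> 'b"
  assumes jmax: "1 \<le> jmax"
    and R: "R \<in> borel_measurable M" "\<And>S. S \<in> space M \<Longrightarrow> norm (R S) \<le> G"
    and D: "\<And>j. D j \<in> borel_measurable M" "\<And>j S. S \<in> space M \<Longrightarrow> norm (D j S) \<le> L"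
    and moment: "\<And>j. 1 \<le> j \<Longrightarrow> j \<le> jmax \<Longrightarrow> (\<integral>S. (norm (D j S))\<^sup>2 \<partial>M) \<le> K / 2 ^ j"
    and K: "0 \<le> K"
  defines "F \<equiv> \<lambda>(J, S). (norm (R S + (1 / pmf (mlmc_level jmax) J) *\<^sub>R D J S))\<^sup>2"
  shows "integrable (measure_pmf (mlmc_level jmax) \<Otimes>\<^sub>M M) F"
    and "(\<integral>\<omega>. F \<omega> \<partial>(measure_pmf (mlmc_level jmax) \<Otimes>\<^sub>M M)) \<le> 2 * G\<^sup>2 + 2 * K * real jmax"
proof -
  define p where "p = mlmc_level jmax"
  have int_D: "integrable M (\<lambda>S. (norm (D j S))\<^sup>2)" for j
    using D by (rule integrable_norm_power2)
  have M_one: "measure M (space M) = 1"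
    by (rule prob_space)
  interpret pair_prob_space "measure_pmf p" M ..
  have F_meas: "(\<lambda>S. F (J, S)) \<in> borel_measurable M" for J
    using R(1) D(1) by (simp add: F_def)
  have F_bound: "norm (F (J, S)) \<le> (G + 2 ^ jmax * L)\<^sup>2" if "S \<in> space M" for J S
  proof -
    have "norm ((1 / pmf p J) *\<^sub>R D J S) \<le> 2 ^ jmax * L"
      using inverse_pmf_mlmc_level_le[OF jmax, of J] D(2)[OF that]
      by (simp only: norm_scaleR abs_of_nonneg zero_le_divide_1_iff pmf_nonneg p_def)
         (intro mult_mono, auto)
    then have "norm (R S + (1 / pmf p J) *\<^sub>R D J S) \<le> G + 2 ^ jmax * L"
      using R(2)[OF that] norm_triangle_ineq[of "R S" "(1 / pmf p J) *\<^sub>R D J S"] by linarith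
    then show ?thesis
      by (simp add: F_def power_mono p_def)
  qed
  have "F \<in> borel_measurable (count_space UNIV \<Otimes>\<^sub>M M)"
    by (rule measurable_pair_measure_countable1) (use F_meas in auto)
  also have "borel_measurable (count_space UNIV \<Otimes>\<^sub>M M) = borel_measurable (measure_pmf p \<Otimes>\<^sub>M M)"
    by (intro measurable_cong_sets sets_pair_measure_cong) auto
  finally have F_meas2: "F \<in> borel_measurable (measure_pmf p \<Otimes>\<^sub>M M)" .
  have int: "integrable (measure_pmf p \<Otimes>\<^sub>M M) F"
    using F_bound
    by (intro P.integrable_const_bound[OF _ F_meas2, of "(G + 2 ^ jmax * L)\<^sup>2"] AE_I2)
       (auto simp: space_pair_measure)
  then show "integrable (measure_pmf (mlmc_level jmax) \<Otimes>\<^sub>M M) F"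
    by (simp add: p_def)
  have level: "pmf p j * (\<integral>S. F (j, S) \<partial>M) \<le> pmf p j * (2 * G\<^sup>2) + 2 * K" if j: "j \<in> {1..jmax}" for j
  proof -
    have p_ge: "1 / 2 ^ j \<le> pmf p j"
      unfolding p_def using j by (intro pmf_mlmc_level_ge) auto
    then have p_pos: "0 < pmf p j"
      by (rule less_le_trans[rotated]) simp
    have "(\<integral>S. F (j, S) \<partial>M) \<le> (\<integral>S. 2 * G\<^sup>2 + 2 / (pmf p j)\<^sup>2 * (norm (D j S))\<^sup>2 \<partial>M)"
    proof (rule integral_mono_AE')
      show "integrable M (\<lambda>S. 2 * G\<^sup>2 + 2 / (pmf p j)\<^sup>2 * (norm (D j S))\<^sup>2)"
        using int_D by simp
      show "AE S in M. F (j, S) \<le> 2 * G\<^sup>2 + 2 / (pmf p j)\<^sup>2 * (norm (D j S))\<^sup>2"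
      proof (rule AE_I2)
        fix S assume S: "S \<in> space M"
        have sq: "(a + b)\<^sup>2 \<le> 2 * a\<^sup>2 + 2 * b\<^sup>2" for a b :: real
          using zero_le_square[of "a - b"] by (simp add: power2_eq_square algebra_simps)
        have "F (j, S) \<le> (norm (R S) + norm ((1 / pmf p j) *\<^sub>R D j S))\<^sup>2"
          unfolding F_def p_def by (simp del: norm_scaleR add: power_mono norm_triangle_ineq)
        also have "\<dots> \<le> 2 * (norm (R S))\<^sup>2 + 2 * (norm ((1 / pmf p j) *\<^sub>R D j S))\<^sup>2"
          by (rule sq)
        also have "(norm (R S))\<^sup>2 \<le> G\<^sup>2"
          using R(2)[OF S] by (intro power_mono) auto
        finally show "F (j, S) \<le> 2 * G\<^sup>2 + 2 / (pmf p j)\<^sup>2 * (norm (D j S))\<^sup>2"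
          by (simp add: power_divide)
      qed
    qed (simp add: F_def)
    also have "\<dots> = 2 * G\<^sup>2 + 2 / (pmf p j)\<^sup>2 * (\<integral>S. (norm (D j S))\<^sup>2 \<partial>M)"
      using int_D by (simp add: M_one)
    also have "\<dots> \<le> 2 * G\<^sup>2 + 2 / (pmf p j)\<^sup>2 * (K / 2 ^ j)"
      using moment[of j] j by (intro add_left_mono mult_left_mono) auto
    finally have "pmf p j * (\<integral>S. F (j, S) \<partial>M) \<le> pmf p j * (2 * G\<^sup>2 + 2 / (pmf p j)\<^sup>2 * (K / 2 ^ j))"
      using p_pos by (intro mult_left_mono) auto
    also have "\<dots> = pmf p j * (2 * G\<^sup>2) + 2 * K * ((1 / 2 ^ j) / pmf p j)"
      using p_pos by (simp add: field_simps power2_eq_square)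
    also have "2 * K * ((1 / 2 ^ j) / pmf p j) \<le> 2 * K * 1"
    proof (rule mult_left_mono)
      show "(1 / 2 ^ j) / pmf p j \<le> 1"
        using p_ge p_pos by (simp only: pos_divide_le_eq mult_1)
    qed (use K in simp)
    finally show ?thesis by simp
  qed
  have "(\<integral>\<omega>. F \<omega> \<partial>(measure_pmf p \<Otimes>\<^sub>M M)) = (\<integral>J. (\<integral>S. F (J, S) \<partial>M) \<partial>measure_pmf p)"
    using integral_fst'[OF int] by simp
  also have "\<dots> = (\<Sum>j\<in>{1..jmax}. pmf p j * (\<integral>S. F (j, S) \<partial>M))"
    using set_pmf_mlmc_level[OF jmax]
    by (subst integral_measure_pmf[of "{1..jmax}"]) (auto simp: p_def)
  also have "\<dots> \<le> (\<Sum>j\<in>{1..jmax}. pmf p j * (2 * G\<^sup>2) + 2 * K)"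
    using level by (rule sum_mono)
  also have "\<dots> = 2 * G\<^sup>2 + 2 * K * real jmax"
  proof -
    have "(\<Sum>j\<in>{1..jmax}. pmf p j) = 1"
      using set_pmf_mlmc_level[OF jmax] by (intro sum_pmf_eq_1) (auto simp: p_def)
    then show ?thesis
      by (simp add: sum.distrib flip: sum_distrib_right)
  qed
  finally show "(\<integral>\<omega>. F \<omega> \<partial>(measure_pmf (mlmc_level jmax) \<Otimes>\<^sub>M M)) \<le> 2 * G\<^sup>2 + 2 * K * real jmax"
    by (simp add: p_def)
qed

lemma mlmc_estimator_second_moment_le:
  fixes X :: "'a::euclidean_space set" and l :: "'a \<Rightarrow> 's \<Rightarrow> real"
  assumes sample: "labelled_sample P0 (l x) (l' x) G"
    and q: "measurable_selection q" "\<And>k v. 1 \<le> k \<Longrightarrow> v \<in> {..<k} \<rightarrow>\<^sub>E UNIV \<Longrightarrow> q k v \<in> weight_simplex k"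
    and n0: "1 \<le> n0" and jmax: "1 \<le> jmax" and K: "0 \<le> K"
    and moment: "\<And>h. 1 \<le> h \<Longrightarrow> (\<integral>S. (norm (labelled_sample.half_difference (l x) (l' x) q h S))\<^sup>2
        \<partial>PiM UNIV (\<lambda>_. P0)) \<le> K * G\<^sup>2 / real (2 * h)"
  shows "integrable (mlmc_space jmax P0) (\<lambda>\<omega>. (norm (mlmc_estimator q l l' x n0 jmax \<omega>))\<^sup>2) \<and>
    (\<integral>\<omega>. (norm (mlmc_estimator q l l' x n0 jmax \<omega>))\<^sup>2 \<partial>mlmc_space jmax P0)
      \<le> 2 * G\<^sup>2 + 4 * K * ln (2 ^ jmax) / real n0 * G\<^sup>2"
proof -
  interpret labelled_sample P0 "l x" "l' x" G by (rule sample)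
  define D where "D j S = half_difference q (2 ^ (j - 1) * n0) S" for j S
  define R where "R S = (\<Sum>i<n0. q n0 (labels n0 S) i *\<^sub>R l' x (S i))" for S
  have R_eq: "robust_grad q l l' x n0 S = R S" for S
    by (simp add: robust_grad_def R_def labels_def)
  have D_eq: "mlmc_diff q l l' x (2 ^ j * n0) S = D j S" if "1 \<le> j" for j S
  proof -
    have "2 ^ j * n0 = 2 * (2 ^ (j - 1) * n0)"
      using that by (cases j) auto
    then show ?thesis
      by (simp only: mlmc_diff_eq_halves D_def half_difference_def labels_def)
  qed
  have simplex: "q k (labels k S) \<in> weight_simplex k" "halves q h v \<in> weight_simplex (2 * h)"
    if "1 \<le> k" "1 \<le> h" for k h S v
    using q(2) that by (auto intro!: halves_in_simplex labels_PiE)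
  have D_bound: "norm (D j S) \<le> 2 * G" if "S \<in> space iid" for j S
  proof -
    define h where "h = 2 ^ (j - 1) * n0"
    have h: "1 \<le> h" using n0 by (simp add: h_def)
    have g: "norm (l' x (S i)) \<le> G" for i
      using g_bound iid_component that by blast
    have "half_difference q h S = (\<Sum>i<2 * h. q (2 * h) (labels (2 * h) S) i *\<^sub>R l' x (S i))
        - (\<Sum>i<2 * h. halves q h (labels (2 * h) S) i *\<^sub>R l' x (S i))"
      by (simp add: half_difference_def scaleR_diff_left sum_subtractf)
    moreover have "norm (\<Sum>i<2 * h. q (2 * h) (labels (2 * h) S) i *\<^sub>R l' x (S i)) \<le> G"
      using simplex(1)[of "2 * h" h S] h g by (intro norm_weighted_sum_le) auto
    moreover have "norm (\<Sum>i<2 * h. halves q h (labels (2 * h) S) i *\<^sub>R l' x (S i)) \<le> G"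
      using simplex(2)[OF h h] g by (intro norm_weighted_sum_le) auto
    ultimately show ?thesis
      unfolding D_def h_def[symmetric] by (smt (verit) norm_triangle_ineq4)
  qed
  define F where "F = (\<lambda>(J, S). (norm (R S + (1 / pmf (mlmc_level jmax) J) *\<^sub>R D J S))\<^sup>2)"
  have "integrable (measure_pmf (mlmc_level jmax) \<Otimes>\<^sub>M iid) F"
    "(\<integral>\<omega>. F \<omega> \<partial>(measure_pmf (mlmc_level jmax) \<Otimes>\<^sub>M iid)) \<le> 2 * G\<^sup>2 + 2 * (K * G\<^sup>2 / real n0) * real jmax"
    unfolding F_def
  proof -
    have a: "R \<in> borel_measurable iid"
      unfolding R_def[abs_def]
      by (intro borel_measurable_sum borel_measurable_scaleR
          selection_measurable[OF q(1) _ labels_measurable]) auto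
    have b: "norm (R S) \<le> G" if "S \<in> space iid" for S
      unfolding R_def using simplex(1)[OF n0 n0] g_bound iid_component[OF that]
      by (intro norm_weighted_sum_le) auto
    have c: "D j \<in> borel_measurable iid" for j
      unfolding D_def[abs_def] by (rule half_difference_measurable[OF q(1)])
    have d: "(\<integral>S. (norm (D j S))\<^sup>2 \<partial>iid) \<le> (K * G\<^sup>2 / real n0) / 2 ^ j" if "1 \<le> j" for j
    proof -
      define h where "h = 2 ^ (j - 1) * n0"
      have "real (2 * h) = 2 ^ j * real n0"
        using that by (cases j) (auto simp: h_def)
      moreover have "(\<integral>S. (norm (half_difference q h S))\<^sup>2 \<partial>iid) \<le> K * G\<^sup>2 / real (2 * h)"
        using n0 by (intro moment) (simp add: h_def)
      ultimately show ?thesis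
        by (simp only: D_def h_def[symmetric] divide_divide_eq_left mult.commute[of "real n0"])
    qed
    have e: "0 \<le> K * G\<^sup>2 / real n0" using K by simp
    note bound = iid.randomized_level_second_moment_le[OF jmax a b c D_bound d e]
    show "integrable (measure_pmf (mlmc_level jmax) \<Otimes>\<^sub>M iid)
       (\<lambda>(J, S). (norm (R S + (1 / pmf (mlmc_level jmax) J) *\<^sub>R D J S))\<^sup>2)"
      by (rule bound)
    show "(\<integral>\<omega>. (case \<omega> of (J, S) \<Rightarrow> (norm (R S + (1 / pmf (mlmc_level jmax) J) *\<^sub>R D J S))\<^sup>2)
       \<partial>(measure_pmf (mlmc_level jmax) \<Otimes>\<^sub>M iid)) \<le> 2 * G\<^sup>2 + 2 * (K * G\<^sup>2 / real n0) * real jmax"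
      by (rule bound)
  qed
  moreover have "(\<lambda>\<omega>. (norm (mlmc_estimator q l l' x n0 jmax \<omega>))\<^sup>2) = F"
  proof (rule ext, clarify)
    fix J :: nat and S :: "nat \<Rightarrow> 's"
    \<comment> \<open>At \<open>J = 0\<close> the sample size \<open>2 ^ J * n0\<close> need not be even, so the difference is not of
        the form of \<open>D\<close>; but this level has probability zero.\<close>
    have "pmf (mlmc_level jmax) J = 0" if "J = 0"
      using set_pmf_mlmc_level[OF jmax] that by (auto simp: pmf_eq_0_set_pmf)
    then show "(norm (mlmc_estimator q l l' x n0 jmax (J, S)))\<^sup>2 = F (J, S)"
      by (cases "J = 0") (simp_all add: mlmc_estimator_def F_def R_eq D_eq)
  qed
  moreover have "2 * (K * G\<^sup>2 / real n0) * real jmax \<le> 4 * K * ln (2 ^ jmax) / real n0 * G\<^sup>2"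
  proof -
    \<comment> \<open>From \<open>ln 2 \<ge> 1 / 2\<close>: this turns the number of levels into a logarithm.\<close>
    have "real jmax * (1 / 2) \<le> real jmax * ln 2"
      using ln2_ge_two_thirds by (intro mult_left_mono) auto
    then have "real jmax \<le> 2 * ln (2 ^ jmax)"
      by (simp add: ln_realpow)
    then have "2 * (K * G\<^sup>2 / real n0) * real jmax \<le> 2 * (K * G\<^sup>2 / real n0) * (2 * ln (2 ^ jmax))"
      using K by (intro mult_left_mono) auto
    then show ?thesis by (simp add: ac_simps)
  qed
  ultimately show ?thesis
    by (simp add: mlmc_space_def)
qed

lemma (in dro_problem) labelled_sample_at:
  assumes "x \<in> X"
  shows "labelled_sample P0 (l x) (l' x) G"
  by unfold_locales (use assms loss_measurable grad_measurable grad_norm in auto)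

theorem proposition4:
  shows "\<exists>C::real. 0 < C \<and> C \<le> 1000 \<and>
    (\<forall>(P0 :: 's measure) (X :: 'a::euclidean_space set) l l' B G.
      dro_problem P0 X l l' B G \<longrightarrow>
      (\<forall>n n0 jmax :: nat. n0 \<ge> 1 \<longrightarrow> jmax \<ge> 1 \<longrightarrow> n = 2 ^ jmax * n0 \<longrightarrow>
        (\<forall>x\<in>X.
          (\<forall>\<alpha> q. 0 < \<alpha> \<longrightarrow> \<alpha> \<le> 1 \<longrightarrow> cvar_selection \<alpha> q \<longrightarrow>
            integrable (mlmc_space jmax P0) (\<lambda>\<omega>. (norm (mlmc_estimator q l l' x n0 jmax \<omega>))\<^sup>2) \<and>
            (\<integral>\<omega>. (norm (mlmc_estimator q l l' x n0 jmax \<omega>))\<^sup>2 \<partial>mlmc_space jmax P0)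
              \<le> C * (1 + ln (real n / real n0) / (\<alpha> * real n0)) * G\<^sup>2) \<and>
          (\<forall>lam q. 0 < lam \<longrightarrow> chi2_selection lam q \<longrightarrow>
            integrable (mlmc_space jmax P0) (\<lambda>\<omega>. (norm (mlmc_estimator q l l' x n0 jmax \<omega>))\<^sup>2) \<and>
            (\<integral>\<omega>. (norm (mlmc_estimator q l l' x n0 jmax \<omega>))\<^sup>2 \<partial>mlmc_space jmax P0)
              \<le> C * (1 + B * ln (real n / real n0) / (lam * real n0)) * G\<^sup>2))))"
\<comment> \<open>The constant 27 for CVaR gets a factor 2 from the square of a sum of two terms, and a factor 2
    from \<open>jmax \<le> 2 * ln (2 ^ jmax)\<close>; this gives 108, and 16 for the penalised objective.\<close>
proof (intro exI[of _ 108] conjI allI impI ballI)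
  fix P0 :: "'s measure" and X :: "'a set" and l l' and B G :: real and n n0 jmax :: nat and x :: 'a
  assume dro: "dro_problem P0 X l l' B G"
    and n0: "1 \<le> n0" and jmax: "1 \<le> jmax" and n: "n = 2 ^ jmax * n0" and x: "x \<in> X"
  interpret dro_problem P0 X l l' B G by (rule dro)
  interpret labelled_sample P0 "l x" "l' x" G by (rule labelled_sample_at[OF x])
  have ratio: "real n / real n0 = 2 ^ jmax"
    using n0 by (simp add: n)
  have ln_nonneg: "0 \<le> ln (2 ^ jmax :: real)"
    by simp
  note estimator = mlmc_estimator_second_moment_le[of P0 l x l' G,
      OF labelled_sample_axioms _ _ n0 jmax]
  {
    fix \<alpha> :: real and q
    assume \<alpha>: "0 < \<alpha>" "\<alpha> \<le> 1" and q: "cvar_selection \<alpha> q"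
    have "integrable (mlmc_space jmax P0) (\<lambda>\<omega>. (norm (mlmc_estimator q l l' x n0 jmax \<omega>))\<^sup>2) \<and>
      (\<integral>\<omega>. (norm (mlmc_estimator q l l' x n0 jmax \<omega>))\<^sup>2 \<partial>mlmc_space jmax P0)
        \<le> 2 * G\<^sup>2 + 4 * (27 / \<alpha>) * ln (2 ^ jmax) / real n0 * G\<^sup>2"
      using q \<alpha> cvar_half_difference_second_moment_le[OF q]
      by (intro estimator) (auto simp: cvar_selection_def cvar_weights_def)
    moreover have "2 * G\<^sup>2 + 4 * (27 / \<alpha>) * ln (2 ^ jmax) / real n0 * G\<^sup>2
        \<le> 108 * G\<^sup>2 + 4 * (27 / \<alpha>) * ln (2 ^ jmax) / real n0 * G\<^sup>2"
      by (intro add_right_mono mult_right_mono) auto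
    moreover have "\<dots> = 108 * (1 + ln (real n / real n0) / (\<alpha> * real n0)) * G\<^sup>2"
      unfolding ratio by (simp add: algebra_simps)
    ultimately show "integrable (mlmc_space jmax P0) (\<lambda>\<omega>. (norm (mlmc_estimator q l l' x n0 jmax \<omega>))\<^sup>2)"
      "(\<integral>\<omega>. (norm (mlmc_estimator q l l' x n0 jmax \<omega>))\<^sup>2 \<partial>mlmc_space jmax P0)
        \<le> 108 * (1 + ln (real n / real n0) / (\<alpha> * real n0)) * G\<^sup>2"
      by linarith+
  next
    fix lam :: real and q
    assume lam: "0 < lam" and q: "chi2_selection lam q"
    have B: "0 \<le> B"
      using not_empty loss_range[OF x] by force
    have "integrable (mlmc_space jmax P0) (\<lambda>\<omega>. (norm (mlmc_estimator q l l' x n0 jmax \<omega>))\<^sup>2) \<and>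
      (\<integral>\<omega>. (norm (mlmc_estimator q l l' x n0 jmax \<omega>))\<^sup>2 \<partial>mlmc_space jmax P0)
        \<le> 2 * G\<^sup>2 + 4 * (4 * B / lam) * ln (2 ^ jmax) / real n0 * G\<^sup>2"
      using q lam B chi2_half_difference_second_moment_le[OF q lam _ loss_range[OF x]]
      by (intro estimator) (auto simp: chi2_selection_def)
    moreover have "2 * G\<^sup>2 + 4 * (4 * B / lam) * ln (2 ^ jmax) / real n0 * G\<^sup>2
        \<le> 108 * G\<^sup>2 + 108 * (B / lam) * ln (2 ^ jmax) / real n0 * G\<^sup>2"
      using B lam ln_nonneg
      by (intro add_mono mult_right_mono divide_right_mono) (auto simp: divide_right_mono)
    moreover have "\<dots> = 108 * (1 + B * ln (real n / real n0) / (lam * real n0)) * G\<^sup>2"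
      unfolding ratio by (simp add: algebra_simps)
    ultimately show "integrable (mlmc_space jmax P0) (\<lambda>\<omega>. (norm (mlmc_estimator q l l' x n0 jmax \<omega>))\<^sup>2)"
      "(\<integral>\<omega>. (norm (mlmc_estimator q l l' x n0 jmax \<omega>))\<^sup>2 \<partial>mlmc_space jmax P0)
        \<le> 108 * (1 + B * ln (real n / real n0) / (lam * real n0)) * G\<^sup>2"
      by linarith+
  }
qed auto

end
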